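(* Let $N_c\to\infty$ and let $r=N_f/N_c\ge1$, where $N_f=rN_c$ is an integer. Suppose one of the following holds: (1) $r-1=o(1)$ as $N_c\to\infty$ (with $t,\tilde t$ fixed, $0<t\tilde t<1$); or (2) $t\tilde t=o(1)$ as $N_c\to\infty$ and $r>1$ is fixed. Then the unrefined Hilbert series of $U(N_c)$ SQCD with $rN_c$ flavours satisfies $$g_{rN_c,U(N_c)}(t,\tilde t)\sim\frac{1-\binom{rN_c}{N_c+1}^2\left[\mathcal F(N_c,r,t\tilde t)\right]^2(t\tilde t)^{N_c+1}}{(1-t\tilde t)^{r^2N_c^2}},\qquad \mathcal F(N_c,r,t\tilde t)={}_2F_1\big(-(r-1)N_c+1,\,rN_c;\,N_c+2;\,t\tilde t\big).$$
   Context: Here $0\le t,\tilde t<1$ and ${}_2F_1$ is the Gauss hypergeometric function. The unrefined Hilbert series of $U(N_c)$ SQCD with $N_f$ flavours is $$g_{N_f,U(N_c)}(t,\tilde t)=\frac{1}{N_c!(2\pi i)^{N_c}}\oint_{|z_1|=1}\frac{dz_1}{z_1}\cdots\oint_{|z_{N_c}|=1}\frac{dz_{N_c}}{z_{N_c}}\prod_{1\le a<b\le N_c}|z_a-z_b|^2\prod_{a=1}^{N_c}\frac{1}{(1-t/z_a)^{N_f}(1-\tilde t z_a)^{N_f}}.$$ The notation $A\sim B$ means that the ratio $A/B$ tends to $1$ in the stated limit. Binomial coefficients $\binom{n}{k}$ with $k>n\ge0$ are zero. *)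

theory Defs
  imports
    "HOL-Complex_Analysis.Complex_Analysis"
    "HOL-Library.Landau_Symbols"
begin

text \<open>The list argument of the integrand holds the integration variables, in the order in which
  the integral signs are written (the first entry belongs to the outermost integral).\<close>

primrec torus_integral :: "nat \<Rightarrow> (complex list \<Rightarrow> complex) \<Rightarrow> complex" where
  "torus_integral 0 F = F []"
| "torus_integral (Suc n) F =
     contour_integral (circlepath 0 1) (\<lambda>z. torus_integral n (\<lambda>zs. F (z # zs)) / z)"

definition sqcd_integrand :: "nat \<Rightarrow> nat \<Rightarrow> real \<Rightarrow> real \<Rightarrow> complex list \<Rightarrow> complex" where
  "sqcd_integrand Nf Nc t t' zs =
     (\<Prod>b<Nc. \<Prod>a<b. complex_of_real ((cmod (zs ! a - zs ! b))\<^sup>2)) *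
     (\<Prod>a<Nc. 1 / ((1 - complex_of_real t / zs ! a) ^ Nf *
                   (1 - complex_of_real t' * zs ! a) ^ Nf))"

definition hilbert_series :: "nat \<Rightarrow> nat \<Rightarrow> real \<Rightarrow> real \<Rightarrow> complex" where
  "hilbert_series Nf Nc t t' =
     1 / (fact Nc * (2 * complex_of_real pi * \<i>) ^ Nc) *
     torus_integral Nc (sqcd_integrand Nf Nc t t')"

text \<open>The last argument of \<open>fps_hypergeo\<close> is a scaling of the variable, hence 1 here.\<close>

definition gauss_2F1 :: "real \<Rightarrow> real \<Rightarrow> real \<Rightarrow> real \<Rightarrow> real" where
  "gauss_2F1 a b c x = eval_fps (fps_hypergeo [a, b] [c] 1) x"

definition calF :: "nat \<Rightarrow> real \<Rightarrow> real \<Rightarrow> real" where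
  "calF Nc r x =
     gauss_2F1 (- (r - 1) * real Nc + 1) (r * real Nc) (real Nc + 2) x"

end

theory Submission
  imports Defs "Jordan_Normal_Form.Determinant"
begin

text \<open>
  Write \<open>x = t t'\<close>, \<open>n = N\<^sub>f\<close>, \<open>N = N\<^sub>c\<close>. Expanding both Vandermonde factors turns the Hilbert series into
  an \<open>N \<times> N\<close> Toeplitz determinant \<open>D\<^sub>N\<close>, which up to a power of \<open>x\<close> is the Gram determinant of the
  sequences \<open>k \<mapsto> binom(k - i + n - 1, n - 1)\<close>, \<open>i < N\<close>, with respect to the weights \<open>x\<^sup>k\<close>.
  Row operations show that \<open>D\<^sub>n\<close> is the inverse of \<open>(1 - x)\<close> to the power \<open>n\<^sup>2\<close>. For general \<open>l\<close>,
  splitting off the first column (\<open>k = 0\<close>) of the \<open>l\<close> sequences produces \<open>D\<^sub>l\<^sub>-\<^sub>1\<close>, and the remaining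
  columns are the old ones shifted by one. In the Cauchy-Binet expansion the shift multiplies the
  square of the minor with distinct columns \<open>h\<close> by \<open>x\<^sup>l\<close> and by the square of
  \<open>\<Prod>\<^sub>j (h\<^sub>j + 1 + n - l) / (h\<^sub>j + 1) \<le> binom(n, l)\<close>, whence
  \<open>0 \<le> D\<^sub>l - D\<^sub>l\<^sub>-\<^sub>1 \<le> binom(n, l)\<^sup>2 x\<^sup>l D\<^sub>l\<close>.
  Summing over \<open>N < l \<le> n\<close> shows that \<open>D\<^sub>N / D\<^sub>n\<close> tends to 1 in both regimes, where the correction term
  of the asymptotic formula is exponentially small as well.
\<close>

section \<open>Determinants of functions of two indices\<close>

text \<open>Taking the entries as a function rather than as a matrix turns row and column changes
  into plain rewriting; values at indices from \<open>n\<close> on do not matter.\<close>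

definition fdet :: "nat \<Rightarrow> (nat \<Rightarrow> nat \<Rightarrow> 'a::comm_ring_1) \<Rightarrow> 'a" where
  "fdet n f = Determinant.det (Matrix.mat n n (\<lambda>(i, j). f i j))"

lemma fdet_sign_sum:
  "fdet n f = (\<Sum>p | p permutes {..<n}. of_int (sign p) * (\<Prod>i<n. f i (p i)))"
proof -
  have "fdet n f = (\<Sum>p | p permutes {0..<n}. of_int (sign p) *
      (\<Prod>i = 0..<n. Matrix.mat n n (\<lambda>(i, j). f i j) $$ (i, p i)))"
    unfolding fdet_def by (subst det_def'[where n = n]) (auto intro!: sum.cong)
  also have "\<dots> = (\<Sum>p | p permutes {..<n}. of_int (sign p) * (\<Prod>i<n. f i (p i)))"
    unfolding atLeast0LessThan
    by (intro sum.cong refl arg_cong2[where f = "(*)"] prod.cong)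
      (use permutes_in_image in \<open>fastforce simp: index_mat\<close>)
  finally show ?thesis .
qed

lemma fdet_cong:
  assumes "\<And>i j. i < n \<Longrightarrow> j < n \<Longrightarrow> f i j = g i j"
  shows "fdet n f = fdet n g"
  unfolding fdet_def by (rule arg_cong[where f = Determinant.det]) (auto intro!: eq_matI assms)

lemma fdet_transpose: "fdet n (\<lambda>i j. f j i) = fdet n f"
proof -
  have "transpose_mat (Matrix.mat n n (\<lambda>(i, j). f i j)) = Matrix.mat n n (\<lambda>(i, j). f j i)"
    by (auto intro!: eq_matI)
  then show ?thesis
    unfolding fdet_def by (metis (no_types) det_transpose mat_carrier)
qed

lemma fdet_permute_rows:
  assumes "p permutes {..<n}"
  shows "fdet n (\<lambda>i j. f (p i) j) = of_int (sign p) * fdet n f"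
proof -
  have "fdet n (\<lambda>i j. f (p i) j) =
      Determinant.det (Matrix.mat n n (\<lambda>(i, j). Matrix.mat n n (\<lambda>(i, j). f i j) $$ (p i, j)))"
    unfolding fdet_def using permutes_in_image[OF assms]
    by (intro arg_cong[where f = Determinant.det] eq_matI) auto
  also have "\<dots> = of_int (sign p) * fdet n f"
    unfolding fdet_def using assms
    by (subst det_permute_rows) (auto simp: atLeast0LessThan)
  finally show ?thesis .
qed

lemma fdet_permute_cols:
  assumes "p permutes {..<n}"
  shows "fdet n (\<lambda>i j. f i (p j)) = of_int (sign p) * fdet n f"
  using fdet_permute_rows[OF assms, of "\<lambda>i j. f j i"]
  by (simp add: fdet_transpose[of n f] fdet_transpose[of n "\<lambda>i j. f i (p j)"])

lemma fdet_mult: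
  "fdet n (\<lambda>i j. \<Sum>k<n. a i k * b k j) = fdet n a * fdet n b"
proof -
  have "Matrix.mat n n (\<lambda>(i, j). \<Sum>k<n. a i k * b k j) =
      Matrix.mat n n (\<lambda>(i, j). a i j) * Matrix.mat n n (\<lambda>(i, j). b i j)"
    by (intro eq_matI) (auto simp: scalar_prod_def atLeast0LessThan)
  then show ?thesis
    unfolding fdet_def by (simp add: det_mult[where n = n])
qed

lemma fdet_lower_triangular:
  assumes "\<And>i j. i < j \<Longrightarrow> j < n \<Longrightarrow> f i j = 0"
  shows "fdet n f = (\<Prod>i<n. f i i)"
proof -
  have "fdet n f = prod_list (diag_mat (Matrix.mat n n (\<lambda>(i, j). f i j)))"
    unfolding fdet_def by (rule det_lower_triangular[where n = n]) (auto simp: assms)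
  also have "\<dots> = (\<Prod>i<n. f i i)"
    by (simp add: prod_list_diag_prod atLeast0LessThan)
  finally show ?thesis .
qed

lemma fdet_upper_triangular:
  assumes "\<And>i j. j < i \<Longrightarrow> i < n \<Longrightarrow> f i j = 0"
  shows "fdet n f = (\<Prod>i<n. f i i)"
  using fdet_lower_triangular[of n "\<lambda>i j. f j i"] assms by (simp add: fdet_transpose[of n f])

lemma fdet_mult_rows: "fdet n (\<lambda>i j. c i * f i j) = (\<Prod>i<n. c i) * fdet n f"
  unfolding fdet_sign_sum sum_distrib_left by (simp add: prod.distrib algebra_simps)

lemma fdet_mult_cols: "fdet n (\<lambda>i j. c j * f i j) = (\<Prod>j<n. c j) * fdet n f"
  using fdet_mult_rows[of n c "\<lambda>i j. f j i"]
  by (simp add: fdet_transpose[of n f] fdet_transpose[of n "\<lambda>i j. c j * f i j"])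

lemma fdet_identical_cols:
  assumes "j < n" "k < n" "j \<noteq> k" "\<And>i. i < n \<Longrightarrow> f i j = f i k"
  shows "fdet n f = 0"
  unfolding fdet_def using assms
  by (intro det_identical_columns[of _ n j k]) (auto intro!: eq_vecI)

text \<open>A determinant is affine in its corner entry, with the complementary minor as slope. In
  the expansion along row 0, a change in that row leaves the cofactors alone.\<close>

lemma fdet_split_corner:
  "fdet (Suc n) f =
    fdet (Suc n) (\<lambda>i j. f i j - (if i = 0 \<and> j = 0 then 1 else 0)) + fdet n (\<lambda>i j. f (Suc i) (Suc j))"
proof -
  let ?A = "Matrix.mat (Suc n) (Suc n) (\<lambda>(i, j). f i j)"
  let ?B = "Matrix.mat (Suc n) (Suc n) (\<lambda>(i, j). f i j - (if i = 0 \<and> j = 0 then 1 else 0))"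
  have del: "mat_delete ?A 0 j = mat_delete ?B 0 j" for j
    by (rule eq_matI) (auto simp: mat_delete_def)
  have "mat_delete ?A 0 0 = Matrix.mat n n (\<lambda>(i, j). f (Suc i) (Suc j))"
    by (rule eq_matI) (auto simp: mat_delete_def)
  then have cof: "cofactor ?A 0 0 = fdet n (\<lambda>i j. f (Suc i) (Suc j))"
    by (simp add: cofactor_def fdet_def)
  have cofeq: "cofactor ?B 0 j = cofactor ?A 0 j" for j
    by (simp add: cofactor_def del)
  have "fdet (Suc n) f = (\<Sum>j<Suc n. ?A $$ (0, j) * cofactor ?A 0 j)"
    unfolding fdet_def by (rule laplace_expansion_row) auto
  also have "\<dots> = (\<Sum>j<Suc n. ?B $$ (0, j) * cofactor ?A 0 j + (if j = 0 then cofactor ?A 0 0 else 0))"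
    by (intro sum.cong) (auto simp: algebra_simps)
  also have "\<dots> = (\<Sum>j<Suc n. ?B $$ (0, j) * cofactor ?B 0 j) + cofactor ?A 0 0"
    unfolding sum.distrib cofeq by simp
  also have "(\<Sum>j<Suc n. ?B $$ (0, j) * cofactor ?B 0 j) = Determinant.det ?B"
    by (rule laplace_expansion_row[symmetric]) auto
  finally show ?thesis
    unfolding cof by (simp add: fdet_def)
qed

section \<open>The Cauchy-Binet formula\<close>

text \<open>Letting \<open>h\<close> run over all functions avoids any ordering of columns: each set
  of \<open>n\<close> columns occurs \<open>n!\<close> times, and repeated columns contribute zero.
  Multilinearity gives a product times one determinant; summing over permutations makes the product
  a determinant too.\<close>

lemma Cauchy_Binet_functions:
  assumes "finite S"
  shows "fact n * fdet n (\<lambda>i j. \<Sum>k\<in>S. a i k * b j k) =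
    (\<Sum>h\<in>PiE {..<n} (\<lambda>_. S). fdet n (\<lambda>i j. a i (h j)) * fdet n (\<lambda>i j. b i (h j)))"
proof -
  let ?H = "PiE {..<n} (\<lambda>_. S)"
  let ?P = "{p. p permutes {..<n}}"
  let ?\<beta> = "\<lambda>h. fdet n (\<lambda>i j. b i (h j))"
  have finP: "finite ?P" by (simp add: finite_permutations)
  have expand: "fdet n (\<lambda>i j. \<Sum>k\<in>S. a i k * b j k) = (\<Sum>h\<in>?H. (\<Prod>i<n. a i (h i)) * ?\<beta> h)"
  proof -
    have "fdet n (\<lambda>i j. \<Sum>k\<in>S. a i k * b j k) =
        (\<Sum>p\<in>?P. of_int (sign p) * (\<Sum>h\<in>?H. \<Prod>i<n. a i (h i) * b (p i) (h i)))"
      unfolding fdet_sign_sum using assms by (simp add: prod_sum_PiE)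
    also have "\<dots> = (\<Sum>h\<in>?H. (\<Prod>i<n. a i (h i)) *
        (\<Sum>p\<in>?P. of_int (sign p) * (\<Prod>i<n. b (p i) (h i))))"
      unfolding sum_distrib_left by (subst sum.swap) (simp add: prod.distrib algebra_simps)
    also have "\<dots> = (\<Sum>h\<in>?H. (\<Prod>i<n. a i (h i)) * fdet n (\<lambda>i j. b j (h i)))"
      unfolding fdet_sign_sum ..
    finally show ?thesis
      using fdet_transpose[of n "\<lambda>i j. b i (h j)" for h] by simp
  qed
  \<comment> \<open>Replacing \<open>h\<close> by \<open>h \<circ> q\<close> permutes the columns of
    the second determinant, which costs \<open>sign q\<close>.\<close>
  have perm: "(\<Sum>h\<in>?H. (\<Prod>i<n. a i (h i)) * ?\<beta> h) =
      (\<Sum>h\<in>?H. of_int (sign q) * (\<Prod>i<n. a i (h (q i))) * ?\<beta> h)" if q: "q permutes {..<n}" for q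
  proof -
    have 1: "h \<circ> s \<in> ?H" if "h \<in> ?H" "s permutes {..<n}" for h s
      using that permutes_in_image[OF that(2)] permutes_not_in[OF that(2)]
      by (auto simp: PiE_def Pi_def extensional_def)
    have bij: "bij_betw (\<lambda>h. h \<circ> q) ?H ?H"
      by (rule bij_betw_byWitness[where f' = "\<lambda>h. h \<circ> Hilbert_Choice.inv q"])
        (use q 1 permutes_inv[OF q] in \<open>auto simp: o_assoc[symmetric] permutes_inv_o[OF q]\<close>)
    have "(\<Sum>h\<in>?H. (\<Prod>i<n. a i (h i)) * ?\<beta> h) =
        (\<Sum>h\<in>?H. (\<Prod>i<n. a i ((h \<circ> q) i)) * ?\<beta> (h \<circ> q))"
      by (rule sum.reindex_bij_betw[OF bij, symmetric])
    also have "\<dots> = (\<Sum>h\<in>?H. of_int (sign q) * (\<Prod>i<n. a i (h (q i))) * ?\<beta> h)"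
      using fdet_permute_cols[OF q, of "\<lambda>i j. b i (h j)" for h] by (simp add: algebra_simps)
    finally show ?thesis .
  qed
  have "card ?P = fact n"
    using card_permutations[of "{..<n}" n] by simp
  then have "fact n * fdet n (\<lambda>i j. \<Sum>k\<in>S. a i k * b j k) =
      (\<Sum>q\<in>?P. \<Sum>h\<in>?H. (\<Prod>i<n. a i (h i)) * ?\<beta> h)"
    by (simp add: expand)
  also have "\<dots> = (\<Sum>q\<in>?P. \<Sum>h\<in>?H. of_int (sign q) * (\<Prod>i<n. a i (h (q i))) * ?\<beta> h)"
    by (rule sum.cong) (auto intro!: perm)
  also have "\<dots> = (\<Sum>h\<in>?H. (\<Sum>q\<in>?P. of_int (sign q) * (\<Prod>i<n. a i (h (q i)))) * ?\<beta> h)"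
    unfolding sum_distrib_right by (rule sum.swap)
  finally show ?thesis
    unfolding fdet_sign_sum[of n "\<lambda>i j. a i (h j)" for h] .
qed

section \<open>Polynomial bases and the Vandermonde determinant\<close>

text \<open>The coefficient matrix that passes from the monomials to the \<open>P i\<close> is lower
  triangular with ones on the diagonal.\<close>

lemma fdet_monic_polys:
  fixes y :: "nat \<Rightarrow> 'a::comm_ring_1"
  assumes "\<And>i. i < n \<Longrightarrow> degree (P i) = i" "\<And>i. i < n \<Longrightarrow> lead_coeff (P i) = 1"
  shows "fdet n (\<lambda>i j. poly (P i) (y j)) = fdet n (\<lambda>i j. y j ^ i)"
proof -
  have "fdet n (\<lambda>i j. poly (P i) (y j)) = fdet n (\<lambda>i j. \<Sum>k<n. coeff (P i) k * y j ^ k)"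
  proof (rule fdet_cong)
    fix i j assume "i < n"
    then have "(\<Sum>k<n. coeff (P i) k * y j ^ k) = (\<Sum>k\<le>i. coeff (P i) k * y j ^ k)"
      by (intro sum.mono_neutral_right) (auto simp: assms(1) coeff_eq_0)
    then show "poly (P i) (y j) = (\<Sum>k<n. coeff (P i) k * y j ^ k)"
      using \<open>i < n\<close> by (simp add: poly_altdef assms(1))
  qed
  also have "\<dots> = fdet n (\<lambda>i k. coeff (P i) k) * fdet n (\<lambda>k j. y j ^ k)"
    by (rule fdet_mult)
  also have "fdet n (\<lambda>i k. coeff (P i) k) = (\<Prod>i<n. coeff (P i) i)"
    by (rule fdet_lower_triangular) (auto simp: assms(1) coeff_eq_0)
  also have "\<dots> = 1"
    using assms by (intro prod.neutral) force
  finally show ?thesis by simp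
qed

lemma monic_linear_factors:
  fixes u :: "nat \<Rightarrow> 'a::idom"
  shows "degree (\<Prod>k<i. [:u k, 1:]) = i" "lead_coeff (\<Prod>k<i. [:u k, 1:]) = 1"
proof -
  show "degree (\<Prod>k<i. [:u k, 1:]) = i"
    by (subst degree_prod_eq_sum_degree) auto
  show "lead_coeff (\<Prod>k<i. [:u k, 1:]) = 1"
    by (simp add: lead_coeff_prod)
qed

text \<open>In the Newton basis for the nodes \<open>y\<close> the Vandermonde matrix is triangular.\<close>

lemma fdet_Vandermonde:
  fixes y :: "nat \<Rightarrow> 'a::idom"
  shows "fdet n (\<lambda>i j. y j ^ i) = (\<Prod>b<n. \<Prod>a<b. y b - y a)"
proof -
  have "fdet n (\<lambda>i j. y j ^ i) = fdet n (\<lambda>i j. poly (\<Prod>k<i. [:- y k, 1:]) (y j))"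
    by (rule fdet_monic_polys[symmetric]) (rule monic_linear_factors)+
  also have "\<dots> = (\<Prod>b<n. poly (\<Prod>k<b. [:- y k, 1:]) (y b))"
    by (rule fdet_upper_triangular) (auto simp: poly_prod prod_zero_iff)
  finally show ?thesis by (simp add: poly_prod)
qed

section \<open>Gram determinants of binomial sequences\<close>

text \<open>Passing from \<open>s\<close> to \<open>Suc s\<close> is a Cauchy product with the
  geometric series, where the hockey-stick identity sums the binomials. Absolute summability is
  carried through the induction because the Cauchy product requires it.\<close>

lemma negative_binomial_sums:
  fixes z :: "'a::{real_normed_field, banach}"
  assumes "norm z < 1"
  shows "(\<lambda>k. of_nat ((k + s) choose s) * z ^ k) sums (1 / (1 - z) ^ Suc s)
    \<and> summable (\<lambda>k. norm (of_nat ((k + s) choose s) * z ^ k))"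
proof (induction s)
  case 0
  then show ?case
    using geometric_sums[OF assms] summable_geometric[of "norm z"] assms by (simp add: norm_power)
next
  case (Suc s)
  let ?f = "\<lambda>k. of_nat ((k + s) choose s) * z ^ k"
  have conv: "(\<Sum>i\<le>k. (i + s choose s)) = (k + Suc s choose Suc s)" for k
    using choose_rising_sum(1)[where n = s and m = k] by (simp add: ac_simps del: binomial_Suc_Suc)
  have eq: "(\<Sum>i\<le>k. ?f i * z ^ (k - i)) = of_nat ((k + Suc s) choose Suc s) * z ^ k" for k
  proof -
    have "(\<Sum>i\<le>k. ?f i * z ^ (k - i)) = (\<Sum>i\<le>k. of_nat ((i + s) choose s) * z ^ k)"
      by (intro sum.cong refl) (simp add: mult.assoc flip: power_add)
    then show ?thesis
      by (simp add: conv flip: sum_distrib_right of_nat_sum)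
  qed
  have geo: "summable (\<lambda>k. norm (z ^ k))"
    using assms by (simp add: norm_power summable_geometric)
  have "(\<lambda>k. \<Sum>i\<le>k. ?f i * z ^ (k - i)) sums ((\<Sum>k. ?f k) * (\<Sum>k. z ^ k))"
    using Suc geo by (intro Cauchy_product_sums) auto
  then have 1: "(\<lambda>k. of_nat ((k + Suc s) choose Suc s) * z ^ k) sums (1 / (1 - z) ^ Suc (Suc s))"
    unfolding eq using Suc geometric_sums[OF assms] by (simp add: sums_iff field_simps)
  have "summable (\<lambda>k. norm (\<Sum>i\<le>k. ?f i * z ^ (k - i)))"
  proof (rule summable_comparison_test')
    show "summable (\<lambda>k. \<Sum>i\<le>k. norm (?f i) * norm (z ^ (k - i)))"
      using Suc geo by (intro summable_Cauchy_product) auto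
    show "norm (norm (\<Sum>i\<le>k. ?f i * z ^ (k - i))) \<le> (\<Sum>i\<le>k. norm (?f i) * norm (z ^ (k - i)))" for k
      by (auto intro!: sum_norm_le simp: norm_mult)
  qed
  with 1 show ?case unfolding eq by simp
qed

section \<open>The Gram matrix of the shifted sequences\<close>

text \<open>This is the coefficient of \<open>z ^ k\<close> in
  \<open>z ^ i / (1 - z) ^ Suc s\<close>. Without the case split, truncated subtraction would give 1
  instead of 0 for \<open>k < i\<close>.\<close>

definition shifted_binom :: "nat \<Rightarrow> nat \<Rightarrow> nat \<Rightarrow> real" where
  "shifted_binom s k i = (if i \<le> k then real ((k - i + s) choose s) else 0)"

lemma shifted_binom_Suc_Suc [simp]: "shifted_binom s (Suc k) (Suc i) = shifted_binom s k i"
  by (simp add: shifted_binom_def)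

lemma shifted_binom_0_left: "shifted_binom s 0 i = (if i = 0 then 1 else 0)"
  by (simp add: shifted_binom_def)

lemma shifted_binom_0_right [simp]: "shifted_binom s k 0 = real ((k + s) choose s)"
  by (simp add: shifted_binom_def)

lemma shifted_binom_nonneg: "shifted_binom s k i \<ge> 0"
  by (simp add: shifted_binom_def)

lemma summable_shifted_binom:
  assumes "0 \<le> y" "y < 1"
  shows "summable (\<lambda>k. shifted_binom s k i * y ^ (k - i))"
proof -
  have "summable (\<lambda>k. shifted_binom s (k + i) i * y ^ (k + i - i))"
    using negative_binomial_sums[of y s] assms by (auto simp: shifted_binom_def sums_iff)
  then show ?thesis
    by (subst (asm) summable_iff_shift)
qed

lemma summable_product:
  fixes f g :: "nat \<Rightarrow> real"
  assumes "summable f" "summable g" "\<And>k. 0 \<le> f k" "\<And>k. 0 \<le> g k"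
  shows "summable (\<lambda>k. f k * g k)"
proof -
  obtain M where M: "\<And>k. norm (f k) \<le> M"
    using summable_imp_Bseq[OF assms(1)] by (auto simp: Bseq_def)
  show ?thesis
  proof (rule summable_comparison_test')
    show "summable (\<lambda>k. M * g k)" by (rule summable_mult[OF assms(2)])
    show "norm (f k * g k) \<le> M * g k" for k
      using M[of k] assms(3,4)[of k] by (simp add: mult_right_mono)
  qed
qed

definition gram :: "nat \<Rightarrow> real \<Rightarrow> nat \<Rightarrow> nat \<Rightarrow> real" where
  "gram s x i j = (\<Sum>k. x ^ k * shifted_binom s k i * shifted_binom s k j)"

lemma summable_gram:
  assumes "0 \<le> x" "x < 1"
  shows "summable (\<lambda>k. x ^ k * shifted_binom s k i * shifted_binom s k j)"
proof -
  \<comment> \<open>Splitting the weight \<open>x ^ k\<close> evenly between the two sequences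
    leaves two separately summable factors.\<close>
  have y: "0 \<le> sqrt x" "sqrt x < 1" using assms by auto
  have 1: "summable (\<lambda>k. shifted_binom s k i * sqrt x ^ k)" for i
  proof -
    have "summable (\<lambda>k. sqrt x ^ i * (shifted_binom s k i * sqrt x ^ (k - i)))"
      by (intro summable_mult summable_shifted_binom y)
    also have "(\<lambda>k. sqrt x ^ i * (shifted_binom s k i * sqrt x ^ (k - i))) =
        (\<lambda>k. shifted_binom s k i * sqrt x ^ k)"
      by (auto simp: fun_eq_iff shifted_binom_def simp flip: power_add)
    finally show ?thesis .
  qed
  have "summable (\<lambda>k. (shifted_binom s k i * sqrt x ^ k) * (shifted_binom s k j * sqrt x ^ k))"
    by (intro summable_product 1) (simp_all add: shifted_binom_nonneg assms)
  also have "(\<lambda>k. (shifted_binom s k i * sqrt x ^ k) * (shifted_binom s k j * sqrt x ^ k)) =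
      (\<lambda>k. x ^ k * shifted_binom s k i * shifted_binom s k j)"
    using assms by (auto simp: fun_eq_iff simp flip: power_mult_distrib)
  finally show ?thesis .
qed

text \<open>Both shifted sequences vanish at \<open>k = 0\<close>, so the summation index moves by
  one and releases a factor \<open>x\<close>.\<close>

lemma gram_Suc_Suc:
  assumes "0 \<le> x" "x < 1"
  shows "gram s x (Suc i) (Suc j) = x * gram s x i j"
proof -
  have "gram s x (Suc i) (Suc j) = (\<Sum>k. x * (x ^ k * shifted_binom s k i * shifted_binom s k j))"
    unfolding gram_def
    using suminf_split_head[OF summable_gram[OF assms], of s "Suc i" "Suc j"]
    by (simp add: shifted_binom_0_left mult.assoc)
  also have "\<dots> = x * gram s x i j"
    unfolding gram_def by (rule suminf_mult[OF summable_gram[OF assms]])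
  finally show ?thesis .
qed

text \<open>Only the sequence with \<open>i = 0\<close> is nonzero at \<open>k = 0\<close>, so the
  corner 1 is exactly the contribution of that column.\<close>

lemma gram_minus_corner:
  assumes "0 \<le> x" "x < 1"
  shows "gram s x i j - (if i = 0 \<and> j = 0 then 1 else 0) =
    (\<Sum>k. x ^ Suc k * shifted_binom s (Suc k) i * shifted_binom s (Suc k) j)"
  unfolding gram_def
  by (subst suminf_split_head[OF summable_gram[OF assms]]) (simp add: shifted_binom_0_left)

lemma tendsto_fdet:
  fixes f :: "'b \<Rightarrow> nat \<Rightarrow> nat \<Rightarrow> 'a::{real_normed_algebra, comm_ring_1}"
  assumes "\<And>i j. i < n \<Longrightarrow> j < n \<Longrightarrow> ((\<lambda>k. f k i j) \<longlongrightarrow> g i j) F"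
  shows "((\<lambda>k. fdet n (f k)) \<longlongrightarrow> fdet n g) F"
  unfolding fdet_sign_sum
  using permutes_in_image
  by (intro tendsto_sum tendsto_mult tendsto_const tendsto_prod assms) fastforce+

text \<open>The coefficients of the \<open>m\<close>-fold backward difference.\<close>

primrec diff_coeff :: "nat \<Rightarrow> nat \<Rightarrow> real" where
  "diff_coeff 0 j = (if j = 0 then 1 else 0)"
| "diff_coeff (Suc m) j = diff_coeff m j - (case j of 0 \<Rightarrow> 0 | Suc i \<Rightarrow> diff_coeff m i)"

lemma diff_coeff_eq_0: "m < j \<Longrightarrow> diff_coeff m j = 0"
  by (induction m arbitrary: j) (auto split: nat.split)

lemma diff_coeff_diag: "diff_coeff m m = (-1) ^ m"
  by (induction m) (auto simp: diff_coeff_eq_0)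

section \<open>Differences of the sequences and their minors\<close>

text \<open>Pascal's rule; on generating functions, multiplication by \<open>1 - z\<close> lowers
  the exponent of the denominator by one.\<close>

lemma shifted_binom_diff:
  "shifted_binom s k i = shifted_binom (Suc s) k i - shifted_binom (Suc s) k (Suc i)"
proof (cases "i < k")
  case True
  then obtain d where "k = i + Suc d" by (metis less_iff_Suc_add add_Suc_right)
  then show ?thesis by (simp add: shifted_binom_def)
qed (auto simp: shifted_binom_def)

lemma shifted_binom_diff_iterated:
  "m \<le> s \<Longrightarrow> shifted_binom (s - m) k i = (\<Sum>j\<le>m. diff_coeff m j * shifted_binom s k (i + j))"
proof (induction m arbitrary: i)
  case (Suc m)
  let ?c = "\<lambda>i. shifted_binom s k i"
  have "shifted_binom (s - Suc m) k i = shifted_binom (s - m) k i - shifted_binom (s - m) k (Suc i)"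
    using Suc.prems shifted_binom_diff[of "s - Suc m" k i] by (simp add: Suc_diff_Suc)
  also have "\<dots> = (\<Sum>j\<le>m. diff_coeff m j * ?c (i + j)) - (\<Sum>j\<le>m. diff_coeff m j * ?c (i + Suc j))"
    using Suc.IH[of i] Suc.IH[of "Suc i"] Suc.prems by simp
  also have "(\<Sum>j\<le>m. diff_coeff m j * ?c (i + j)) = (\<Sum>j\<le>Suc m. diff_coeff m j * ?c (i + j))"
    by (simp add: diff_coeff_eq_0)
  also have "(\<Sum>j\<le>m. diff_coeff m j * ?c (i + Suc j)) =
      (\<Sum>j\<le>Suc m. (case j of 0 \<Rightarrow> 0 | Suc l \<Rightarrow> diff_coeff m l) * ?c (i + j))"
    by (subst sum.atMost_Suc_shift) simp
  finally show ?case
    by (simp add: sum_subtractf left_diff_distrib del: sum.atMost_Suc)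
qed simp

text \<open>The recombined rows are unshifted binomials, hence polynomials in \<open>k\<close> of
  degree \<open>s - m\<close> with no cutoff left.\<close>

lemma binom_eq_diff:
  assumes "m \<le> s" "m < l"
  shows "real (k + (s - m) choose (s - m)) = (\<Sum>j<l. diff_coeff m j * shifted_binom s k j)"
proof -
  have "(\<Sum>j<l. diff_coeff m j * shifted_binom s k j) = (\<Sum>j\<le>m. diff_coeff m j * shifted_binom s k j)"
    using assms by (intro sum.mono_neutral_right) (auto simp: diff_coeff_eq_0)
  then show ?thesis
    using shifted_binom_diff_iterated[OF assms(1), of k 0] by simp
qed

lemma fdet_diff_coeff_sq: "(fdet l diff_coeff)\<^sup>2 = 1"
  using fdet_lower_triangular[of l diff_coeff]
  by (simp add: diff_coeff_eq_0 diff_coeff_diag prod_power_distrib flip: power_mult)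

lemma reverse_permutes: "(\<lambda>m. if m < l then l - Suc m else m) permutes {..<l}"
proof (rule bij_imp_permutes)
  show "bij_betw (\<lambda>m. if m < l then l - Suc m else m) {..<l} {..<l}"
    by (rule bij_betw_byWitness[where f' = "\<lambda>m. if m < l then l - Suc m else m"]) auto
qed auto

lemma of_int_sign_sq: "(of_int (sign p) :: 'a::comm_ring_1)\<^sup>2 = 1"
  by (simp add: sign_def)

text \<open>Squaring spares computing the sign of the reversal; squares of minors are also what
  Cauchy-Binet produces.\<close>

lemma fdet_reverse_rows_sq:
  fixes f :: "nat \<Rightarrow> nat \<Rightarrow> 'a::comm_ring_1"
  shows "(fdet l (\<lambda>i j. f (l - Suc i) j))\<^sup>2 = (fdet l f)\<^sup>2"
proof -
  have "fdet l (\<lambda>i j. f (l - Suc i) j) = fdet l (\<lambda>i j. f (if i < l then l - Suc i else i) j)"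
    by (rule fdet_cong) simp
  then show ?thesis
    by (simp add: fdet_permute_rows[OF reverse_permutes] power_mult_distrib of_int_sign_sq)
qed

lemma binom_pochhammer: "real (k + q choose q) = pochhammer (real k + 1) q / fact q"
  by (simp add: binomial_gbinomial gbinomial_pochhammer')

text \<open>Taking differences of rows has determinant 1 or -1 and turns row \<open>m\<close> into
  \<open>pochhammer (h + 1) (s - m) / fact (s - m)\<close>. In each column all rows share the first
  \<open>Suc s - l\<close> factors; what remains are monic polynomials of degrees
  \<open>l - 1\<close> down to 0, that is, a Vandermonde determinant.\<close>

lemma fdet_shifted_binom_sq:
  fixes h :: "nat \<Rightarrow> nat"
  assumes "l \<le> Suc s"
  shows "(fdet l (\<lambda>i j. shifted_binom s (h j) i))\<^sup>2 =
    ((\<Prod>m<l. 1 / fact (s - m)) * (\<Prod>j<l. pochhammer (real (h j) + 1) (Suc s - l)) *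
     (\<Prod>b<l. \<Prod>a<b. real (h b) - real (h a)))\<^sup>2"
proof -
  let ?d = "Suc s - l"
  have "(fdet l (\<lambda>i j. shifted_binom s (h j) i))\<^sup>2 =
      (fdet l diff_coeff * fdet l (\<lambda>i j. shifted_binom s (h j) i))\<^sup>2"
    by (simp add: power_mult_distrib fdet_diff_coeff_sq)
  also have "fdet l diff_coeff * fdet l (\<lambda>i j. shifted_binom s (h j) i) =
      fdet l (\<lambda>m j. real (h j + (s - m) choose (s - m)))"
    unfolding fdet_mult[symmetric] using assms
    by (intro fdet_cong binom_eq_diff[symmetric]) auto
  also have "\<dots> = fdet l (\<lambda>m j. (1 / fact (s - m)) * (pochhammer (real (h j) + 1) ?d *
      pochhammer (real (h j) + 1 + real ?d) (l - Suc m)))"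
  proof (rule fdet_cong)
    fix m j assume m: "m < l"
    have "pochhammer (real (h j) + 1) (s - m) = pochhammer (real (h j) + 1) ?d *
        pochhammer (real (h j) + 1 + real ?d) (s - m - ?d)"
      using m assms by (intro pochhammer_product) auto
    moreover have "s - m - ?d = l - Suc m" using m assms by auto
    ultimately show "real (h j + (s - m) choose (s - m)) = (1 / fact (s - m)) *
        (pochhammer (real (h j) + 1) ?d * pochhammer (real (h j) + 1 + real ?d) (l - Suc m))"
      by (simp add: binom_pochhammer)
  qed
  also have "\<dots> = (\<Prod>m<l. 1 / fact (s - m)) * ((\<Prod>j<l. pochhammer (real (h j) + 1) ?d) *
      fdet l (\<lambda>m j. pochhammer (real (h j) + 1 + real ?d) (l - Suc m)))"
    by (simp only: fdet_mult_rows fdet_mult_cols)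
  also have "\<dots>\<^sup>2 = ((\<Prod>m<l. 1 / fact (s - m)) * (\<Prod>j<l. pochhammer (real (h j) + 1) ?d))\<^sup>2 *
      (fdet l (\<lambda>m j. pochhammer (real (h j) + 1 + real ?d) m))\<^sup>2"
    using fdet_reverse_rows_sq[of l "\<lambda>m j. pochhammer (real (h j) + 1 + real ?d) m"]
    by (simp add: power_mult_distrib)
  also have "fdet l (\<lambda>m j. pochhammer (real (h j) + 1 + real ?d) m) =
      fdet l (\<lambda>m j. poly (\<Prod>k<m. [:1 + real ?d + real k, 1:]) (real (h j)))"
    by (intro fdet_cong) (simp add: pochhammer_prod poly_prod atLeast0LessThan algebra_simps)
  also have "\<dots> = fdet l (\<lambda>m j. real (h j) ^ m)"
    by (rule fdet_monic_polys) (rule monic_linear_factors)+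
  also have "\<dots> = (\<Prod>b<l. \<Prod>a<b. real (h b) - real (h a))"
    by (rule fdet_Vandermonde)
  finally show ?thesis by (simp add: power_mult_distrib)
qed

text \<open>Each factor \<open>1 + d / (s + 1)\<close> decreases in \<open>s\<close>, so among sets
  of a given size the initial segment has the largest product, and there it is a binomial
  coefficient. The induction removes the maximum, which is at least the number of the other
  elements.\<close>

lemma prod_ratio_le:
  assumes "finite S"
  shows "(\<Prod>s\<in>S. (real s + 1 + real d) / (real s + 1)) \<le> real ((card S + d) choose d)"
proof -
  have "(\<Prod>s\<in>S. (real s + 1 + real d) / (real s + 1)) \<le>
      (\<Prod>i<card S. (real i + 1 + real d) / (real i + 1))"
    using assms
  proof (induction "card S" arbitrary: S)
    case (Suc n)
    let ?M = "Max S"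
    have ne: "S \<noteq> {}" using Suc.hyps(2) by auto
    have M: "?M \<in> S" by (rule Max_in[OF Suc.prems ne])
    have card: "card (S - {?M}) = n" using Suc.hyps(2) M Suc.prems by simp
    have "S - {?M} \<subseteq> {..<?M}" using Suc.prems by (auto simp: less_le)
    then have "n \<le> ?M" using card card_mono[of "{..<?M}" "S - {?M}"] by simp
    then have le: "(real ?M + 1 + real d) / (real ?M + 1) \<le> (real n + 1 + real d) / (real n + 1)"
      by (simp add: divide_simps) (simp add: algebra_simps mult_left_mono)
    have "(\<Prod>s\<in>S. (real s + 1 + real d) / (real s + 1)) =
        (real ?M + 1 + real d) / (real ?M + 1) * (\<Prod>s\<in>S - {?M}. (real s + 1 + real d) / (real s + 1))"
      by (rule prod.remove[OF Suc.prems M])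
    also have "\<dots> \<le> (real n + 1 + real d) / (real n + 1) *
        (\<Prod>i<n. (real i + 1 + real d) / (real i + 1))"
      using le Suc.hyps(1)[of "S - {?M}"] card Suc.prems
      by (intro mult_mono) (auto intro!: prod_nonneg)
    finally show ?case by (simp add: Suc.hyps(2)[symmetric] mult.commute)
  qed simp
  also have "(\<Prod>i<m. (real i + 1 + real d) / (real i + 1)) = real ((m + d) choose d)" for m
  proof (induction m)
    case (Suc m)
    have "Suc m * (Suc (m + d) choose Suc m) = Suc (m + d) * ((m + d) choose m)"
      by (rule Suc_times_binomial_eq[symmetric, simplified mult.commute]) 
    then have "real (Suc m) * real (Suc (m + d) choose Suc m) = real (Suc (m + d)) * real ((m + d) choose m)"
      by (metis of_nat_mult)
    moreover have "Suc (m + d) choose Suc m = (Suc m + d choose d)" "(m + d) choose m = (m + d) choose d"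
      using binomial_symmetric[of "Suc m" "Suc (m + d)"] binomial_symmetric[of m "m + d"] by auto
    ultimately have "(real m + 1) * real ((Suc m + d) choose d) = (real m + 1 + real d) * real ((m + d) choose d)"
      by (simp add: add.commute add.left_commute del: binomial_Suc_Suc)
    then show ?case
      unfolding prod.lessThan_Suc Suc.IH by (simp add: field_simps del: binomial_Suc_Suc)
  qed simp
  finally show ?thesis .
qed

text \<open>In the product formula for the squared minor, a shift of all columns leaves the
  Vandermonde factor alone and multiplies each Pochhammer factor by
  \<open>(h + 1 + d) / (h + 1)\<close>, where \<open>d = Suc s - l\<close>.\<close>

lemma fdet_shifted_binom_shift_le:
  fixes h :: "nat \<Rightarrow> nat"
  assumes "l \<le> Suc s"
  shows "(fdet l (\<lambda>i j. shifted_binom s (Suc (h j)) i))\<^sup>2 \<le>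
    (real (Suc s choose l))\<^sup>2 * (fdet l (\<lambda>i j. shifted_binom s (h j) i))\<^sup>2"
proof (cases "inj_on h {..<l}")
  \<comment> \<open>The bound on the product is for a set of distinct columns; repeated ones make
    the left-hand side zero.\<close>
  case False
  then obtain j k where "j < l" "k < l" "j \<noteq> k" "h j = h k"
    by (auto simp: inj_on_def)
  then have "fdet l (\<lambda>i j. shifted_binom s (Suc (h j)) i) = 0"
    by (intro fdet_identical_cols[of j l k]) auto
  then show ?thesis by simp
next
  case True
  let ?d = "Suc s - l"
  let ?R = "\<Prod>j<l. (real (h j) + 1 + real ?d) / (real (h j) + 1)"
  have "?R = (\<Prod>k\<in>h ` {..<l}. (real k + 1 + real ?d) / (real k + 1))"
    using True by (simp add: prod.reindex)
  also have "\<dots> \<le> real ((l + ?d) choose ?d)"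
    using prod_ratio_le[of "h ` {..<l}" ?d] True by (simp add: card_image)
  also have "(l + ?d) choose ?d = Suc s choose l"
    using assms binomial_symmetric[of l "Suc s"] by simp
  finally have R: "?R \<le> real (Suc s choose l)" .
  have R0: "?R \<ge> 0" by (intro prod_nonneg) auto
  have poch: "pochhammer (real (Suc k) + 1) ?d =
      (real k + 1 + real ?d) / (real k + 1) * pochhammer (real k + 1) ?d" for k
    using pochhammer_rec[of "real k + 1" ?d] pochhammer_rec'[of "real k + 1" ?d]
    by (simp add: field_simps)
  have "(fdet l (\<lambda>i j. shifted_binom s (Suc (h j)) i))\<^sup>2 =
      ?R\<^sup>2 * (fdet l (\<lambda>i j. shifted_binom s (h j) i))\<^sup>2"
    unfolding fdet_shifted_binom_sq[OF assms] poch prod.distrib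
    by (simp add: power_mult_distrib)
  also have "\<dots> \<le> (real (Suc s choose l))\<^sup>2 * (fdet l (\<lambda>i j. shifted_binom s (h j) i))\<^sup>2"
    by (intro mult_right_mono power_mono R R0) auto
  finally show ?thesis .
qed

text \<open>The index map \<open>f\<close> covers two matrices at once: \<open>id\<close> gives the
  truncated Gram matrix, \<open>Suc\<close> a truncation without the term
  \<open>k = 0\<close>.\<close>

lemma fdet_partial_gram:
  fixes K :: nat
  shows "fact l * fdet l (\<lambda>i j. \<Sum>k<K. x ^ f k * shifted_binom s (f k) i * shifted_binom s (f k) j) =
    (\<Sum>h\<in>PiE {..<l} (\<lambda>_. {..<K}). (\<Prod>j<l. x ^ f (h j)) * (fdet l (\<lambda>i j. shifted_binom s (f (h j)) i))\<^sup>2)"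
  by (subst Cauchy_Binet_functions)
    (simp_all add: fdet_mult_cols power2_eq_square mult.assoc)

text \<open>For truncated sums, Cauchy-Binet writes both determinants as weighted sums of squared
  minors. This gives the sign at once and lets the upper bound be checked minor by minor; both
  bounds survive the limit.\<close>

lemma gram_minus_corner_bounds:
  assumes "l \<le> Suc s" "0 \<le> x" "x < 1"
  defines "g \<equiv> fdet l (\<lambda>i j. gram s x i j - (if i = 0 \<and> j = 0 then 1 else 0))"
  shows "0 \<le> g" "g \<le> x ^ l * (real (Suc s choose l))\<^sup>2 * fdet l (gram s x)"
proof -
  let ?P = "\<lambda>f K. fdet l (\<lambda>i j. \<Sum>k<K. x ^ f k * shifted_binom s (f k) i * shifted_binom s (f k) j)"
  have lim1: "(\<lambda>K. ?P Suc K) \<longlonglongrightarrow> g"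
    unfolding g_def gram_minus_corner[OF assms(2,3)]
    by (intro tendsto_fdet summable_LIMSEQ summable_Suc_iff[THEN iffD2, OF summable_gram[OF assms(2,3)]])
  have lim2: "(\<lambda>K. ?P id K) \<longlonglongrightarrow> fdet l (gram s x)"
    unfolding gram_def id_def by (intro tendsto_fdet summable_LIMSEQ summable_gram[OF assms(2,3)])
  have nonneg': "(fact l :: real) * ?P Suc K \<ge> 0" for K
    unfolding fdet_partial_gram using assms by (intro sum_nonneg mult_nonneg_nonneg prod_nonneg) auto
  have nonneg: "?P Suc K \<ge> 0" for K
    by (rule mult_left_le_imp_le[of "fact l"]) (use nonneg'[of K] in simp_all)
  have "(fact l :: real) * ?P Suc K \<le> fact l * (x ^ l * (real (Suc s choose l))\<^sup>2 * ?P id K)" for K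
  proof -
    have "fact l * ?P Suc K \<le> (\<Sum>h\<in>PiE {..<l} (\<lambda>_. {..<K}). (\<Prod>j<l. x ^ Suc (h j)) *
        ((real (Suc s choose l))\<^sup>2 * (fdet l (\<lambda>i j. shifted_binom s (h j) i))\<^sup>2))"
      unfolding fdet_partial_gram using assms(2)
      by (intro sum_mono mult_left_mono fdet_shifted_binom_shift_le assms(1) prod_nonneg) auto
    \<comment> \<open>Each of the \<open>l\<close> columns carries one more power of
      \<open>x\<close>, which gives \<open>x ^ l\<close>.\<close>
    also have "\<dots> = x ^ l * (real (Suc s choose l))\<^sup>2 * (fact l * ?P id K)"
      unfolding fdet_partial_gram sum_distrib_left
      by (intro sum.cong refl) (simp add: prod.distrib algebra_simps)
    finally show ?thesis by (simp add: algebra_simps)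
  qed
  then have le: "?P Suc K \<le> x ^ l * (real (Suc s choose l))\<^sup>2 * ?P id K" for K
    by (rule mult_left_le_imp_le) simp
  show "0 \<le> g" by (rule LIMSEQ_le_const[OF lim1]) (use nonneg in blast)
  show "g \<le> x ^ l * (real (Suc s choose l))\<^sup>2 * fdet l (gram s x)"
    by (rule LIMSEQ_le[OF lim1 tendsto_mult_left[OF lim2]]) (use le in auto)
qed

text \<open>The minor left after removing row and column 0 is the smaller Gram matrix with every row
  scaled by \<open>x\<close>.\<close>

lemma fdet_gram_Suc:
  assumes "0 \<le> x" "x < 1"
  shows "fdet (Suc l) (gram s x) =
    fdet (Suc l) (\<lambda>i j. gram s x i j - (if i = 0 \<and> j = 0 then 1 else 0)) + x ^ l * fdet l (gram s x)"
  using fdet_split_corner[of l "gram s x"] fdet_mult_rows[of l "\<lambda>_. x" "gram s x"]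
  by (simp add: gram_Suc_Suc[OF assms])

section \<open>The full-size determinant in closed form\<close>

text \<open>Vandermonde's convolution, in the form that factors binomial matrices into triangular
  ones.\<close>

lemma choose_add_eq_sum: "real (k + m choose m) = (\<Sum>p\<le>m. real (k choose p) * real (m choose p))"
proof -
  have "k + m choose m = (\<Sum>p\<le>m. (k choose p) * (m choose (m - p)))"
    by (rule vandermonde[symmetric])
  also have "\<dots> = (\<Sum>p\<le>m. (k choose p) * (m choose p))"
    by (intro sum.cong refl) (simp add: binomial_symmetric[symmetric])
  finally show ?thesis by simp
qed

text \<open>Both sides are the multinomial \<open>(k + m)! / (m! p! (k - p)!)\<close>; for
  \<open>p > k\<close> both vanish.\<close>

lemma choose_add_mult_choose: "(k + m choose m) * (k choose p) = (k + m choose (m + p)) * (m + p choose p)"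
proof (cases "p \<le> k")
  case True
  then have "(k + m choose (m + p)) * (m + p choose m) = (k + m choose m) * (k + m - m choose (m + p - m))"
    by (intro choose_mult) auto
  then show ?thesis
    using binomial_symmetric[of m "m + p"] by simp
qed (simp add: binomial_eq_0)

lemma shifted_negative_binomial_sums:
  fixes x :: real
  assumes "0 \<le> x" "x < 1"
  shows "(\<lambda>k. x ^ k * real (k + m choose (m + p))) sums (x ^ p / (1 - x) ^ Suc (m + p))"
proof -
  have "(\<lambda>k. x ^ p * (real (k + (m + p) choose (m + p)) * x ^ k)) sums (x ^ p * (1 / (1 - x) ^ Suc (m + p)))"
    using negative_binomial_sums[of x "m + p"] assms by (intro sums_mult) auto
  then have "(\<lambda>k. x ^ (k + p) * real (k + p + m choose (m + p))) sums (x ^ p / (1 - x) ^ Suc (m + p))"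
    by (simp add: power_add ac_simps)
  then show ?thesis
    by (subst (asm) sums_zero_iff_shift) (auto simp: binomial_eq_0)
qed

lemma fdet_choose_rows: "fdet n (\<lambda>p m. real (m choose p)) = 1"
  by (subst fdet_upper_triangular) (auto simp: binomial_eq_0)

text \<open>Pascal's matrix is a lower triangular matrix with unit diagonal times its
  transpose.\<close>

lemma fdet_Pascal: "fdet n (\<lambda>m p. real (m + p choose p)) = 1"
proof -
  have "fdet n (\<lambda>m p. real (m + p choose p)) =
      fdet n (\<lambda>m p. \<Sum>q<n. real (m choose q) * real (p choose q))"
  proof (rule fdet_cong)
    fix m p assume "p < n"
    then have "(\<Sum>q<n. real (m choose q) * real (p choose q)) = (\<Sum>q\<le>p. real (m choose q) * real (p choose q))"
      by (intro sum.mono_neutral_right) (auto simp: binomial_eq_0)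
    then show "real (m + p choose p) = (\<Sum>q<n. real (m choose q) * real (p choose q))"
      by (simp add: choose_add_eq_sum)
  qed
  also have "\<dots> = fdet n (\<lambda>m q. real (m choose q)) * fdet n (\<lambda>q p. real (p choose q))"
    by (rule fdet_mult)
  also have "fdet n (\<lambda>m q. real (m choose q)) = fdet n (\<lambda>q m. real (m choose q))"
    by (rule fdet_transpose)
  finally show ?thesis by (simp add: fdet_choose_rows)
qed

text \<open>Expanding only the second binomial in terms of \<open>k choose p\<close> splits off a
  triangular factor with unit diagonal. The other factor, \<open>?M\<close>, is Pascal's matrix up
  to scalings of rows and columns.\<close>

lemma fdet_binomial_gram:
  assumes "0 \<le> x" "x < 1"
  shows "fdet n (\<lambda>m m'. \<Sum>k. x ^ k * real (k + m choose m) * real (k + m' choose m')) =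
    x ^ (\<Sum>i<n. i) / (1 - x) ^ (n\<^sup>2)"
proof -
  let ?M = "\<lambda>m p. x ^ p / (1 - x) ^ Suc (m + p) * real (m + p choose p)"
  have entry: "(\<Sum>k. x ^ k * real (k + m choose m) * real (k + m' choose m')) =
      (\<Sum>p<n. ?M m p * real (m' choose p))" if "m' < n" for m m'
  proof -
    have "(\<lambda>k. \<Sum>p\<le>m'. x ^ k * real (k + m choose (m + p)) * (real (m + p choose p) * real (m' choose p)))
        sums (\<Sum>p\<le>m'. x ^ p / (1 - x) ^ Suc (m + p) * (real (m + p choose p) * real (m' choose p)))"
      by (intro sums_sum sums_mult2 shifted_negative_binomial_sums assms)
    moreover have "(\<Sum>p\<le>m'. x ^ k * real (k + m choose (m + p)) * (real (m + p choose p) * real (m' choose p))) =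
        x ^ k * real (k + m choose m) * real (k + m' choose m')" for k
    proof -
      have "real (k + m choose (m + p)) * real (m + p choose p) = real (k + m choose m) * real (k choose p)" for p
        using choose_add_mult_choose[of k m p] by (metis of_nat_mult)
      then show ?thesis
        unfolding choose_add_eq_sum[of k m'] sum_distrib_left
        by (intro sum.cong refl) (simp add: algebra_simps)
    qed
    ultimately have "(\<Sum>k. x ^ k * real (k + m choose m) * real (k + m' choose m')) =
        (\<Sum>p\<le>m'. ?M m p * real (m' choose p))"
      by (simp add: sums_iff mult.assoc)
    also have "\<dots> = (\<Sum>p<n. ?M m p * real (m' choose p))"
      using that by (intro sum.mono_neutral_left) (auto simp: binomial_eq_0)
    finally show ?thesis .
  qed
  have "fdet n (\<lambda>m m'. \<Sum>k. x ^ k * real (k + m choose m) * real (k + m' choose m')) =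
      fdet n (\<lambda>m m'. \<Sum>p<n. ?M m p * real (m' choose p))"
    by (rule fdet_cong) (rule entry)
  also have "\<dots> = fdet n ?M"
    by (simp only: fdet_mult fdet_choose_rows mult_1_right)
  also have "\<dots> = fdet n (\<lambda>m p. (1 / (1 - x) ^ Suc m) * ((x / (1 - x)) ^ p * real (m + p choose p)))"
    using assms by (intro fdet_cong) (simp add: power_add power_divide)
  also have "\<dots> = (\<Prod>m<n. 1 / (1 - x) ^ Suc m) * (\<Prod>p<n. (x / (1 - x)) ^ p)"
    by (simp only: fdet_mult_rows fdet_mult_cols fdet_Pascal mult_1_right)
  also have "\<dots> = x ^ (\<Sum>i<n. i) / (1 - x) ^ (n\<^sup>2)"
  proof (induction n)
    case (Suc n)
    \<comment> \<open>Row \<open>n\<close> brings the exponent \<open>n + 1\<close> of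
      \<open>1 - x\<close> and column \<open>n\<close> brings \<open>n\<close>, which together are
      the increment of the square.\<close>
    have "Suc n ^ 2 = n\<^sup>2 + Suc n + n" by (simp add: power2_eq_square)
    then show ?case
      using Suc assms by (simp add: power_add power_divide field_simps)
  qed simp
  finally show ?thesis .
qed

text \<open>With \<open>Suc s\<close> rows the differences reach every degree from \<open>s\<close>
  down to 0, so the matrix becomes that of \<open>fdet_binomial_gram\<close> in reverse order. The
  same changes act on rows and on columns, so all signs cancel.\<close>

lemma fdet_gram_full:
  assumes "0 \<le> x" "x < 1"
  shows "fdet (Suc s) (gram s x) = x ^ (\<Sum>i<Suc s. i) / (1 - x) ^ (Suc s)\<^sup>2"
proof -
  let ?n = "Suc s"
  let ?B = "\<lambda>m m'. \<Sum>k. x ^ k * real (k + m choose m) * real (k + m' choose m')"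
  have entry: "?B (s - m) (s - m') = (\<Sum>i<?n. diff_coeff m i * (\<Sum>j<?n. gram s x i j * diff_coeff m' j))"
    if "m < ?n" "m' < ?n" for m m'
  proof -
    have "(\<lambda>k. \<Sum>i<?n. diff_coeff m i * (\<Sum>j<?n. (x ^ k * shifted_binom s k i * shifted_binom s k j) * diff_coeff m' j))
        sums (\<Sum>i<?n. diff_coeff m i * (\<Sum>j<?n. gram s x i j * diff_coeff m' j))"
      unfolding gram_def
      by (intro sums_sum sums_mult sums_mult2 summable_sums summable_gram assms)
    moreover have "(\<Sum>i<?n. diff_coeff m i * (\<Sum>j<?n. (x ^ k * shifted_binom s k i * shifted_binom s k j) * diff_coeff m' j))
        = x ^ k * real (k + (s - m) choose (s - m)) * real (k + (s - m') choose (s - m'))" for k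
    proof -
      have "real (k + (s - m) choose (s - m)) = (\<Sum>i<?n. diff_coeff m i * shifted_binom s k i)"
        "real (k + (s - m') choose (s - m')) = (\<Sum>i<?n. diff_coeff m' i * shifted_binom s k i)"
        using that by (intro binom_eq_diff; simp)+
      then have "x ^ k * real (k + (s - m) choose (s - m)) * real (k + (s - m') choose (s - m')) =
          x ^ k * (\<Sum>i<?n. \<Sum>j<?n. (diff_coeff m i * shifted_binom s k i) * (diff_coeff m' j * shifted_binom s k j))"
        by (simp only: sum_product mult.assoc[of "x ^ k"])
      also have "\<dots> = (\<Sum>i<?n. diff_coeff m i * (\<Sum>j<?n. (x ^ k * shifted_binom s k i * shifted_binom s k j) * diff_coeff m' j))"
        unfolding sum_distrib_left by (intro sum.cong refl) (simp only: ac_simps)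
      finally show ?thesis ..
    qed
    ultimately show ?thesis by (simp only: sums_iff)
  qed
  have "fdet ?n (\<lambda>m m'. ?B (s - m) (s - m')) =
      fdet ?n diff_coeff * (fdet ?n (gram s x) * fdet ?n (\<lambda>j m'. diff_coeff m' j))"
    unfolding fdet_mult[symmetric] by (rule fdet_cong) (rule entry)
  also have "\<dots> = fdet ?n (gram s x)"
    using fdet_diff_coeff_sq[of ?n] fdet_transpose[of ?n diff_coeff] by (simp add: power2_eq_square)
  also have "fdet ?n (\<lambda>m m'. ?B (s - m) (s - m')) = fdet ?n ?B"
  proof -
    let ?r = "\<lambda>m. if m < ?n then ?n - Suc m else m"
    have "fdet ?n (\<lambda>m m'. ?B (s - m) (s - m')) = fdet ?n (\<lambda>m m'. ?B (?r m) (?r m'))"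
      by (rule fdet_cong) simp
    also have "\<dots> = fdet ?n ?B"
      using fdet_permute_rows[OF reverse_permutes[of ?n], of "\<lambda>m m'. ?B m (?r m')"]
        fdet_permute_cols[OF reverse_permutes[of ?n], of ?B] of_int_sign_sq[where 'a = real and p = ?r]
      by (simp add: power2_eq_square flip: mult.assoc)
    finally show ?thesis .
  qed
  finally show ?thesis using fdet_binomial_gram[OF assms, of ?n] by simp
qed

text \<open>The quotient \<open>D\<^sub>l / D\<^sub>n\<close>; for \<open>x = 0\<close> and \<open>l \<ge> 2\<close> it is the junk value 0.\<close>

definition toeplitz_ratio :: "nat \<Rightarrow> real \<Rightarrow> nat \<Rightarrow> real" where
  "toeplitz_ratio n x l = fdet l (gram (n - 1) x) / x ^ (\<Sum>i<l. i) * (1 - x) ^ n\<^sup>2"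

section \<open>Comparison of consecutive sizes\<close>

text \<open>The normalising power of \<open>x\<close> absorbs the factor \<open>x ^ l\<close> in
  \<open>fdet_gram_Suc\<close>, so the increment is the scaled determinant with the corner
  reduced.\<close>

lemma toeplitz_ratio_step:
  assumes "l < n" "0 < x" "x < 1"
  shows "toeplitz_ratio n x l \<le> toeplitz_ratio n x (Suc l)"
    and "toeplitz_ratio n x (Suc l) - toeplitz_ratio n x l \<le>
      x ^ Suc l * (real (n choose Suc l))\<^sup>2 * toeplitz_ratio n x (Suc l)"
proof -
  have n: "Suc (n - 1) = n" using assms by simp
  let ?g = "fdet (Suc l) (\<lambda>i j. gram (n - 1) x i j - (if i = 0 \<and> j = 0 then 1 else 0))"
  let ?c = "(1 - x) ^ n\<^sup>2 / x ^ (\<Sum>i<Suc l. i)"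
  have c: "?c \<ge> 0" using assms by simp
  have g: "0 \<le> ?g" "?g \<le> x ^ Suc l * (real (n choose Suc l))\<^sup>2 * fdet (Suc l) (gram (n - 1) x)"
    using gram_minus_corner_bounds[of "Suc l" "n - 1" x] assms n by auto
  have "fdet (Suc l) (gram (n - 1) x) = ?g + x ^ l * fdet l (gram (n - 1) x)"
    using assms by (intro fdet_gram_Suc) auto
  then have diff: "toeplitz_ratio n x (Suc l) - toeplitz_ratio n x l = ?g * ?c"
    using assms by (simp add: toeplitz_ratio_def power_add field_simps)
  show "toeplitz_ratio n x l \<le> toeplitz_ratio n x (Suc l)"
    using diff mult_nonneg_nonneg[OF g(1) c] by simp
  show "toeplitz_ratio n x (Suc l) - toeplitz_ratio n x l \<le>
      x ^ Suc l * (real (n choose Suc l))\<^sup>2 * toeplitz_ratio n x (Suc l)"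
    unfolding diff using mult_right_mono[OF g(2) c] by (simp add: toeplitz_ratio_def mult.assoc)
qed

lemma toeplitz_ratio_full:
  assumes "0 < n" "0 < x" "x < 1"
  shows "toeplitz_ratio n x n = 1"
  using fdet_gram_full[of x "n - 1"] assms by (simp add: toeplitz_ratio_def del: sum.lessThan_Suc)

text \<open>Downward induction from the value 1 at size \<open>n\<close>. The upper bound 1 turns
  the relative error of each step into an absolute one, so the errors simply add up.\<close>

lemma toeplitz_ratio_bounds:
  assumes "N \<le> n" "0 < n" "0 < x" "x < 1"
  shows "toeplitz_ratio n x N \<le> 1"
    and "1 - (\<Sum>l\<in>{N<..n}. x ^ l * (real (n choose l))\<^sup>2) \<le> toeplitz_ratio n x N"
proof -
  have "toeplitz_ratio n x N \<le> 1 \<and>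
      1 - (\<Sum>l\<in>{N<..n}. x ^ l * (real (n choose l))\<^sup>2) \<le> toeplitz_ratio n x N"
    using assms(1)
  proof (induction rule: inc_induct)
    case base
    then show ?case using toeplitz_ratio_full[OF assms(2-4)] by simp
  next
    case (step l)
    let ?e = "x ^ Suc l * (real (n choose Suc l))\<^sup>2"
    have "{l<..n} = insert (Suc l) {Suc l<..n}" using step.hyps by auto
    then have split: "(\<Sum>l\<in>{l<..n}. x ^ l * (real (n choose l))\<^sup>2) =
        ?e + (\<Sum>l\<in>{Suc l<..n}. x ^ l * (real (n choose l))\<^sup>2)"
      by simp
    have "?e * toeplitz_ratio n x (Suc l) \<le> ?e"
      using step.IH assms by (intro mult_left_le) auto
    then show ?case
      unfolding split using step.IH toeplitz_ratio_step[OF step.hyps(2) assms(3,4)] by linarith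
  qed
  then show "toeplitz_ratio n x N \<le> 1"
    and "1 - (\<Sum>l\<in>{N<..n}. x ^ l * (real (n choose l))\<^sup>2) \<le> toeplitz_ratio n x N"
    by auto
qed

section \<open>The Hilbert series as a Toeplitz determinant\<close>

text \<open>On the torus \<open>cnj z\<close> equals \<open>1 / z\<close>; restricting to it is what
  allows the squared moduli to be replaced by rational functions.\<close>

lemma torus_integral_cong:
  assumes "\<And>zs. length zs = n \<Longrightarrow> (\<And>a. a < n \<Longrightarrow> norm (zs ! a) = 1) \<Longrightarrow> F zs = G zs"
  shows "torus_integral n F = torus_integral n G"
  using assms
proof (induction n arbitrary: F G)
  case (Suc n)
  have "torus_integral n (\<lambda>zs. F (z # zs)) = torus_integral n (\<lambda>zs. G (z # zs))" if "norm z = 1" for z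
    using that by (intro Suc.IH Suc.prems) (auto simp: less_Suc_eq_0_disj)
  then show ?case
    by (auto intro!: contour_integral_eq simp: dist_norm)
qed simp

text \<open>Products of one-variable functions are integrated from the inside out by linearity,
  without changing the order of integration.\<close>

lemma torus_integral_sum_prod:
  assumes "finite S"
    and "\<And>s a. s \<in> S \<Longrightarrow> a < n \<Longrightarrow> (\<lambda>z. g s a z / z) contour_integrable_on circlepath 0 1"
  shows "torus_integral n (\<lambda>zs. \<Sum>s\<in>S. C s * (\<Prod>a<n. g s a (zs ! a))) =
    (\<Sum>s\<in>S. C s * (\<Prod>a<n. contour_integral (circlepath 0 1) (\<lambda>z. g s a z / z)))"
  using assms(2)
proof (induction n arbitrary: C g)
  case (Suc n)
  let ?I = "\<lambda>s a. contour_integral (circlepath 0 1) (\<lambda>z. g s a z / z)"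
  \<comment> \<open>For the inner integrals the outer variable is a parameter, absorbed into the
    coefficient.\<close>
  have inner: "torus_integral n (\<lambda>zs. \<Sum>s\<in>S. C s * (\<Prod>a<Suc n. g s a ((z # zs) ! a))) =
      (\<Sum>s\<in>S. C s * g s 0 z * (\<Prod>a<n. ?I s (Suc a)))" for z
    using Suc.IH[of "\<lambda>s a. g s (Suc a)" "\<lambda>s. C s * g s 0 z"] Suc.prems
    by (simp add: prod.lessThan_Suc_shift mult.assoc del: prod.lessThan_Suc)
  have "torus_integral (Suc n) (\<lambda>zs. \<Sum>s\<in>S. C s * (\<Prod>a<Suc n. g s a (zs ! a))) =
      contour_integral (circlepath 0 1) (\<lambda>z. \<Sum>s\<in>S. (C s * (\<Prod>a<n. ?I s (Suc a))) * (g s 0 z / z))"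
    unfolding torus_integral.simps inner by (simp add: sum_divide_distrib ac_simps)
  also have "\<dots> = (\<Sum>s\<in>S. (C s * (\<Prod>a<n. ?I s (Suc a))) * ?I s 0)"
    by (subst contour_integral_sum[OF assms(1)])
      (intro contour_integrable_lmul sum.cong refl contour_integral_lmul Suc.prems; simp)+
  finally show ?case
    by (simp add: prod.lessThan_Suc_shift ac_simps del: prod.lessThan_Suc torus_integral.simps)
qed simp

text \<open>Orthogonality of powers on the circle, with inverse powers as \<open>(1 / z) ^ b\<close>
  so that exponents stay natural. Both cases are Cauchy's formula at 0: for a power of
  \<open>u\<close>, or for a derivative of the constant 1.\<close>

lemma has_contour_integral_monomial:
  "((\<lambda>z. z ^ a * (1 / z) ^ b / z) has_contour_integral (if a = b then 2 * complex_of_real pi * \<i> else 0))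
    (circlepath 0 1)"
proof (cases "b \<le> a")
  case True
  then obtain c where c: "a = b + c" using le_Suc_ex by blast
  have "((\<lambda>u. u ^ (a - b) / (u - 0) ^ Suc 0) has_contour_integral
      (2 * pi * \<i> / fact 0) * (deriv ^^ 0) (\<lambda>u. u ^ (a - b)) 0) (circlepath 0 1)"
    by (rule Cauchy_has_contour_integral_higher_derivative_circlepath)
      (auto intro!: continuous_intros holomorphic_intros)
  then have "((\<lambda>u. u ^ (a - b) / u) has_contour_integral (if a = b then 2 * complex_of_real pi * \<i> else 0))
      (circlepath 0 1)"
    using True by (cases "a = b") (simp_all add: power_0_left)
  then show ?thesis
    by (rule has_contour_integral_eq) (auto simp: c power_add power_divide)
next
  case False
  then obtain m where m: "b = a + Suc m" by (metis less_iff_Suc_add not_le add_Suc_right)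
  have "((\<lambda>u. 1 / (u - 0) ^ Suc (Suc m)) has_contour_integral
      (2 * pi * \<i> / fact (Suc m)) * (deriv ^^ Suc m) (\<lambda>u. 1) 0) (circlepath 0 1)"
    by (rule Cauchy_has_contour_integral_higher_derivative_circlepath)
      (auto intro!: continuous_intros holomorphic_intros)
  moreover have "(deriv ^^ Suc m) (\<lambda>u::complex. 1) 0 = 0"
    by (subst higher_deriv_const) simp
  ultimately have "((\<lambda>u. 1 / u ^ Suc (Suc m)) has_contour_integral 0) (circlepath 0 1)"
    by simp
  then have "((\<lambda>z. z ^ a * (1 / z) ^ b / z) has_contour_integral 0) (circlepath 0 1)"
    by (rule has_contour_integral_eq) (auto simp: m power_divide power_add)
  then show ?thesis using m by simp
qed

section \<open>Fourier coefficients of the symbol\<close>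

text \<open>This is the Laurent coefficient of index \<open>j - i\<close>, an integer, of
  \<open>1 / ((1 - t / z) ^ Suc s * (1 - t' * z) ^ Suc s)\<close>. The index \<open>k\<close> is the
  common value \<open>i + a = j + b\<close> for the exponents \<open>a\<close> of \<open>t'\<close>
  and \<open>b\<close> of \<open>t\<close>, which puts the sum in Gram form.\<close>

definition toeplitz :: "nat \<Rightarrow> real \<Rightarrow> real \<Rightarrow> nat \<Rightarrow> nat \<Rightarrow> real" where
  "toeplitz s t t' i j =
    (\<Sum>k. (shifted_binom s k i * t' ^ (k - i)) * (shifted_binom s k j * t ^ (k - j)))"

lemma summable_toeplitz:
  assumes "0 \<le> t" "t < 1" "0 \<le> t'" "t' < 1"
  shows "summable (\<lambda>k. (shifted_binom s k i * t' ^ (k - i)) * (shifted_binom s k j * t ^ (k - j)))"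
  using assms by (intro summable_product summable_shifted_binom) (auto simp: shifted_binom_nonneg)

lemma toeplitz_swap: "toeplitz s t t' i j = toeplitz s t' t j i"
  by (simp add: toeplitz_def mult.commute)

lemma truncated_toeplitz_tendsto_le:
  assumes "0 \<le> t" "t < 1" "0 \<le> t'" "t' < 1" "i \<le> j"
  shows "(\<lambda>K. \<Sum>k<K. \<Sum>l<K. if i + k = j + l
      then (real (k + s choose s) * t' ^ k) * (real (l + s choose s) * t ^ l) else 0) \<longlonglongrightarrow> toeplitz s t t' i j"
proof -
  obtain d where j: "j = i + d" using assms(5) le_Suc_ex by blast
  let ?A = "\<lambda>k. real (k + s choose s) * t' ^ k"
  let ?B = "\<lambda>k. real (k + s choose s) * t ^ k"
  let ?f = "\<lambda>k. (shifted_binom s k i * t' ^ (k - i)) * (shifted_binom s k j * t ^ (k - j))"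
  have shift: "?f (l + j) = ?A (l + d) * ?B l" for l
    by (simp add: shifted_binom_def j)
  have "?f sums toeplitz s t t' i j"
    unfolding toeplitz_def by (intro summable_sums summable_toeplitz assms)
  then have "(\<lambda>l. ?f (l + j)) sums toeplitz s t t' i j"
    by (subst sums_zero_iff_shift) (auto simp: shifted_binom_def)
  then have lim: "(\<lambda>K. \<Sum>l<K. ?A (l + d) * ?B l) \<longlonglongrightarrow> toeplitz s t t' i j"
    unfolding shift by (simp add: sums_def)
  \<comment> \<open>On a square of side \<open>K + d\<close> the constraint \<open>k = l + d\<close>
    leaves exactly the indices \<open>l < K\<close>, hence a partial sum of the series.\<close>
  have eq: "(\<Sum>k<K + d. \<Sum>l<K + d. if i + k = j + l then ?A k * ?B l else 0) =
      (\<Sum>l<K. ?A (l + d) * ?B l)" for K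
  proof -
    have "(\<Sum>k<K + d. \<Sum>l<K + d. if i + k = j + l then ?A k * ?B l else 0) =
        (\<Sum>l<K + d. \<Sum>k<K + d. if k = l + d then ?A (l + d) * ?B l else 0)"
      by (subst sum.swap) (auto intro!: sum.cong simp: j)
    also have "\<dots> = (\<Sum>l<K + d. if l < K then ?A (l + d) * ?B l else 0)"
      by simp
    also have "\<dots> = (\<Sum>l<K. ?A (l + d) * ?B l)"
      by (rule sum.mono_neutral_cong_right) auto
    finally show ?thesis .
  qed
  show ?thesis
    by (rule LIMSEQ_offset[where k = d]) (use lim in \<open>simp only: eq\<close>)
qed

lemma truncated_toeplitz_tendsto:
  assumes "0 \<le> t" "t < 1" "0 \<le> t'" "t' < 1"
  shows "(\<lambda>K. \<Sum>k<K. \<Sum>l<K. if i + k = j + l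
      then (real (k + s choose s) * t' ^ k) * (real (l + s choose s) * t ^ l) else 0) \<longlonglongrightarrow> toeplitz s t t' i j"
proof (cases "i \<le> j")
  case True
  then show ?thesis by (intro truncated_toeplitz_tendsto_le assms)
next
  case False
  \<comment> \<open>Exchanging \<open>i\<close> with \<open>j\<close> and \<open>t\<close> with
    \<open>t'\<close> leads back to the other case.\<close>
  let ?f = "\<lambda>k l. if i + k = j + l
      then (real (k + s choose s) * t' ^ k) * (real (l + s choose s) * t ^ l) else 0"
  have "(if j + l = i + k
      then (real (l + s choose s) * t ^ l) * (real (k + s choose s) * t' ^ k) else 0) = ?f k l" for k l
    by auto
  then have "(\<lambda>K. \<Sum>l<K. \<Sum>k<K. ?f k l) \<longlonglongrightarrow> toeplitz s t' t j i"
    using truncated_toeplitz_tendsto_le[of t' t j i s] assms False by simp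
  moreover have "(\<Sum>l<K. \<Sum>k<K. ?f k l) = (\<Sum>k<K. \<Sum>l<K. ?f k l)" for K
    by (rule sum.swap)
  ultimately show ?thesis
    by (simp only: toeplitz_swap[of s t t' i j])
qed

lemma fdet_of_real: "fdet n (\<lambda>i j. of_real (f i j) :: complex) = of_real (fdet n f)"
  unfolding fdet_sign_sum by simp

text \<open>Both factors are negative binomial series, which converge uniformly on the circle by the
  M-test because \<open>t\<close> and \<open>t'\<close> are below 1. Hence the integrals of the
  truncated products, known from the monomials, converge to the integral sought.\<close>

lemma toeplitz_contour_integral:
  fixes t t' :: real and s :: nat
  assumes "0 \<le> t" "t < 1" "0 \<le> t'" "t' < 1"
  defines "f \<equiv> (\<lambda>z::complex. 1 / ((1 - of_real t / z) ^ Suc s * (1 - of_real t' * z) ^ Suc s))"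
  shows "(\<lambda>z. z ^ i * (1 / z) ^ j * f z / z) contour_integrable_on circlepath 0 1"
    and "contour_integral (circlepath 0 1) (\<lambda>z. z ^ i * (1 / z) ^ j * f z / z) =
      2 * complex_of_real pi * \<i> * of_real (toeplitz s t t' i j)"
proof -
  let ?b = "\<lambda>k. of_nat (k + s choose s) :: complex"
  let ?\<Phi> = "\<lambda>z::complex. 1 / (1 - of_real t' * z) ^ Suc s"
  let ?\<Psi> = "\<lambda>z::complex. 1 / (1 - of_real t / z) ^ Suc s"
  let ?\<Phi>K = "\<lambda>K z. \<Sum>k<K. ?b k * (of_real t' * z) ^ k"
  let ?\<Psi>K = "\<lambda>K z. \<Sum>l<K. ?b l * (of_real t / z) ^ l"
  let ?m = "\<lambda>z::complex. z ^ i * (1 / z) ^ j / z"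
  have ne: "1 - of_real r * w \<noteq> 0" if "norm w = 1" "0 \<le> r" "r < 1" for w :: complex and r
  proof
    assume "1 - of_real r * w = 0"
    then have "norm (of_real r * w) = norm (1::complex)" by simp
    then show False using that by (simp add: norm_mult)
  qed
  have ne': "1 - of_real t / z \<noteq> 0" if "norm z = 1" for z :: complex
    using ne[of "1 / z" t] that assms by (simp add: norm_divide)
  have cont: "continuous_on (sphere 0 1) ?\<Phi>" "continuous_on (sphere 0 1) ?\<Psi>"
    "continuous_on (sphere 0 1) ?m"
    using ne[of _ t'] ne' assms by (auto intro!: continuous_intros)
  have bdd: "bounded (h ` sphere 0 1)" if "continuous_on (sphere 0 1) h" for h :: "complex \<Rightarrow> complex"
    by (rule compact_imp_bounded[OF compact_continuous_image[OF that]]) simp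
  have unif: "uniform_limit (sphere 0 1) (\<lambda>K z. \<Sum>k<K. ?b k * (of_real r * w z) ^ k)
      (\<lambda>z. 1 / (1 - of_real r * w z) ^ Suc s) sequentially"
    if "0 \<le> r" "r < 1" "\<And>z. norm z = 1 \<Longrightarrow> norm (w z) = 1" for r and w :: "complex \<Rightarrow> complex"
  proof -
    have "uniform_limit (sphere 0 1) (\<lambda>K z. \<Sum>k<K. ?b k * (of_real r * w z) ^ k)
        (\<lambda>z. suminf (\<lambda>k. ?b k * (of_real r * w z) ^ k)) sequentially"
    proof (rule Weierstrass_m_test)
      show "summable (\<lambda>k. real (k + s choose s) * r ^ k)"
        using negative_binomial_sums[of r s] that by (auto simp: sums_iff)
    qed (use that in \<open>auto simp: norm_mult norm_power\<close>)
    moreover have "suminf (\<lambda>k. ?b k * (of_real r * w z) ^ k) = 1 / (1 - of_real r * w z) ^ Suc s"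
      if "z \<in> sphere 0 1" for z
      using negative_binomial_sums[of "of_real r * w z" s] that \<open>0 \<le> r\<close> \<open>r < 1\<close>
        \<open>\<And>z. norm z = 1 \<Longrightarrow> norm (w z) = 1\<close>[of z]
      by (simp add: sums_iff norm_mult)
    ultimately show ?thesis
      by (subst uniform_limit_cong'[OF refl]) auto
  qed
  have u1: "uniform_limit (sphere 0 1) ?\<Phi>K ?\<Phi> sequentially"
    using unif[of t' "\<lambda>z. z"] assms by simp
  have u2: "uniform_limit (sphere 0 1) ?\<Psi>K ?\<Psi> sequentially"
    using unif[of t "\<lambda>z. 1 / z"] assms by (simp add: norm_divide)
  have "uniform_limit (sphere 0 1) (\<lambda>K z. ?m z * (?\<Phi>K K z * ?\<Psi>K K z)) (\<lambda>z. ?m z * (?\<Phi> z * ?\<Psi> z)) sequentially"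
    by (intro uniform_lim_mult uniform_limit_const u1 u2 bdd cont continuous_on_mult)
  then have u: "uniform_limit (sphere 0 1) (\<lambda>K z. ?m z * (?\<Phi>K K z * ?\<Psi>K K z))
      (\<lambda>z. z ^ i * (1 / z) ^ j * f z / z) sequentially"
    by (simp add: f_def mult.commute)
  let ?c = "\<lambda>k l. if i + k = j + l
      then (real (k + s choose s) * t' ^ k) * (real (l + s choose s) * t ^ l) else 0"
  have int: "((\<lambda>z. ?m z * (?\<Phi>K K z * ?\<Psi>K K z)) has_contour_integral
      2 * complex_of_real pi * \<i> * of_real (\<Sum>k<K. \<Sum>l<K. ?c k l)) (circlepath 0 1)" for K
  proof -
    have "((\<lambda>z. \<Sum>k<K. \<Sum>l<K. (?b k * of_real t' ^ k * (?b l * of_real t ^ l)) * (z ^ (i + k) * (1 / z) ^ (j + l) / z))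
        has_contour_integral (\<Sum>k<K. \<Sum>l<K. (?b k * of_real t' ^ k * (?b l * of_real t ^ l)) *
          (if i + k = j + l then 2 * complex_of_real pi * \<i> else 0))) (circlepath 0 1)"
      by (intro has_contour_integral_sum has_contour_integral_lmul has_contour_integral_monomial) auto
    moreover have "(\<Sum>k<K. \<Sum>l<K. (?b k * of_real t' ^ k * (?b l * of_real t ^ l)) *
          (if i + k = j + l then 2 * complex_of_real pi * \<i> else 0)) =
        2 * complex_of_real pi * \<i> * of_real (\<Sum>k<K. \<Sum>l<K. ?c k l)"
      unfolding of_real_sum sum_distrib_left by (intro sum.cong refl) simp
    moreover have "(\<Sum>k<K. \<Sum>l<K. (?b k * of_real t' ^ k * (?b l * of_real t ^ l)) *
        (z ^ (i + k) * (1 / z) ^ (j + l) / z)) = ?m z * (?\<Phi>K K z * ?\<Psi>K K z)" for z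
      by (simp only: sum_product)
        (simp only: sum_distrib_left, intro sum.cong refl,
          simp add: power_add power_mult_distrib power_divide ac_simps)
    ultimately show ?thesis by simp
  qed
  have ev: "\<forall>\<^sub>F K in sequentially. (\<lambda>z. ?m z * (?\<Phi>K K z * ?\<Psi>K K z)) contour_integrable_on circlepath 0 1"
    by (intro always_eventually allI has_contour_integral_integrable[OF int])
  show "(\<lambda>z. z ^ i * (1 / z) ^ j * f z / z) contour_integrable_on circlepath 0 1"
    by (rule contour_integral_uniform_limit_circlepath(1)[OF ev u]) auto
  have "(\<lambda>K. contour_integral (circlepath 0 1) (\<lambda>z. ?m z * (?\<Phi>K K z * ?\<Psi>K K z))) \<longlonglongrightarrow>
      contour_integral (circlepath 0 1) (\<lambda>z. z ^ i * (1 / z) ^ j * f z / z)"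
    by (rule contour_integral_uniform_limit_circlepath(2)[OF ev u]) auto
  moreover have "(\<lambda>K. contour_integral (circlepath 0 1) (\<lambda>z. ?m z * (?\<Phi>K K z * ?\<Psi>K K z))) \<longlonglongrightarrow>
      2 * complex_of_real pi * \<i> * of_real (toeplitz s t t' i j)"
    unfolding contour_integral_unique[OF int]
    by (intro tendsto_mult_left tendsto_of_real truncated_toeplitz_tendsto assms)
  ultimately show "contour_integral (circlepath 0 1) (\<lambda>z. z ^ i * (1 / z) ^ j * f z / z) =
      2 * complex_of_real pi * \<i> * of_real (toeplitz s t t' i j)"
    by (rule LIMSEQ_unique)
qed

text \<open>On the torus the squared modulus of the Vandermonde product is the product for the
  variables times the product for their inverses. Expanding both over permutations leaves products
  of one-variable integrals.\<close>

lemma hilbert_series_eq_toeplitz: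
  assumes "0 \<le> t" "t < 1" "0 \<le> t'" "t' < 1"
  shows "hilbert_series (Suc s) N t t' = of_real (fdet N (toeplitz s t t'))"
proof -
  let ?P = "{p. p permutes {..<N}}"
  let ?f = "\<lambda>z::complex. 1 / ((1 - of_real t / z) ^ Suc s * (1 - of_real t' * z) ^ Suc s)"
  let ?g = "\<lambda>pq a z. z ^ (fst pq a) * (1 / z) ^ (snd pq a) * ?f z"
  let ?C = "\<lambda>pq. of_int (sign (fst pq)) * of_int (sign (snd pq)) :: complex"
  let ?J = "\<lambda>i j. 2 * complex_of_real pi * \<i> * of_real (toeplitz s t t' i j)"
  have finP: "finite ?P" by (simp add: finite_permutations)
  have integrand: "sqcd_integrand (Suc s) N t t' zs = (\<Sum>pq\<in>?P \<times> ?P. ?C pq * (\<Prod>a<N. ?g pq a (zs ! a)))"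
    if "\<And>a. a < N \<Longrightarrow> norm (zs ! a) = 1" for zs
  proof -
    have V: "(\<Prod>b<N. \<Prod>a<b. y b - y a) = (\<Sum>p\<in>?P. of_int (sign p) * (\<Prod>a<N. y a ^ p a))"
      for y :: "nat \<Rightarrow> complex"
      using fdet_Vandermonde[of N y] fdet_transpose[of N "\<lambda>i j. y j ^ i"]
      by (simp add: fdet_sign_sum[of N "\<lambda>i j. y i ^ j"])
    have norm_sq: "complex_of_real ((cmod (zs ! a - zs ! b))\<^sup>2) =
        (zs ! b - zs ! a) * (1 / zs ! b - 1 / zs ! a)" if ab: "a < b" "b < N" for a b
    proof -
      have "cnj (zs ! c) = 1 / zs ! c" if "c < N" for c
        using \<open>\<And>a. a < N \<Longrightarrow> norm (zs ! a) = 1\<close>[OF that] complex_div_cnj[of 1 "zs ! c"] by simp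
      then show ?thesis
        using ab unfolding complex_norm_square by (simp add: algebra_simps)
    qed
    have "(\<Prod>b<N. \<Prod>a<b. complex_of_real ((cmod (zs ! a - zs ! b))\<^sup>2)) =
        (\<Prod>b<N. \<Prod>a<b. zs ! b - zs ! a) * (\<Prod>b<N. \<Prod>a<b. 1 / zs ! b - 1 / zs ! a)"
      unfolding prod.distrib[symmetric] by (intro prod.cong refl norm_sq) auto
    also have "\<dots> = (\<Sum>pq\<in>?P \<times> ?P. ?C pq * (\<Prod>a<N. (zs ! a) ^ (fst pq a) * (1 / zs ! a) ^ (snd pq a)))"
      unfolding V[of "\<lambda>a. zs ! a"] V[of "\<lambda>a. 1 / zs ! a"] sum_product sum.cartesian_product
      by (intro sum.cong refl) (auto simp: prod.distrib)
    finally have E: "(\<Prod>b<N. \<Prod>a<b. complex_of_real ((cmod (zs ! a - zs ! b))\<^sup>2)) =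
        (\<Sum>pq\<in>?P \<times> ?P. ?C pq * (\<Prod>a<N. (zs ! a) ^ (fst pq a) * (1 / zs ! a) ^ (snd pq a)))" .
    show ?thesis
      unfolding sqcd_integrand_def E sum_distrib_right
      by (intro sum.cong refl) (simp only: prod.distrib mult.assoc)
  qed
  have "torus_integral N (sqcd_integrand (Suc s) N t t') =
      torus_integral N (\<lambda>zs. \<Sum>pq\<in>?P \<times> ?P. ?C pq * (\<Prod>a<N. ?g pq a (zs ! a)))"
    by (rule torus_integral_cong) (rule integrand)
  also have "\<dots> = (\<Sum>pq\<in>?P \<times> ?P. ?C pq * (\<Prod>a<N. ?J (fst pq a) (snd pq a)))"
    using finP toeplitz_contour_integral[OF assms, of _ _ s]
    by (subst torus_integral_sum_prod) auto
  also have "\<dots> = (\<Sum>p\<in>?P. of_int (sign p) * (\<Sum>q\<in>?P. of_int (sign q) * (\<Prod>a<N. ?J (p a) (q a))))"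
    by (simp add: sum.cartesian_product' sum_distrib_left mult.assoc)
  also have "\<dots> = (\<Sum>p\<in>?P. of_int (sign p) * fdet N (\<lambda>a b. ?J (p a) b))"
    unfolding fdet_sign_sum ..
  \<comment> \<open>Undoing the row permutation yields \<open>sign p\<close> a second time, so every
    \<open>p\<close> contributes equally; the resulting \<open>fact N\<close> cancels the
    prefactor.\<close>
  also have "\<dots> = (\<Sum>p\<in>?P. fdet N ?J)"
  proof (intro sum.cong refl)
    fix p assume "p \<in> ?P"
    then show "of_int (sign p) * fdet N (\<lambda>a b. ?J (p a) b) = fdet N ?J"
      using fdet_permute_rows[of p N ?J] of_int_sign_sq[where 'a = complex and p = p]
      by (simp add: power2_eq_square flip: mult.assoc)
  qed
  also have "\<dots> = fact N * ((2 * complex_of_real pi * \<i>) ^ N * of_real (fdet N (toeplitz s t t')))"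
    using card_permutations[of "{..<N}" N] by (simp add: fdet_mult_rows fdet_of_real)
  finally show ?thesis
    unfolding hilbert_series_def by simp
qed

section \<open>From Toeplitz to Gram determinants\<close>

text \<open>For \<open>k\<close> beyond both cutoffs, \<open>t' ^ (k - i) * t ^ (k - j)\<close> is
  \<open>(t * t') ^ k\<close> divided by powers that depend on the row or the column alone; the
  division calls for nonzero \<open>t\<close> and \<open>t'\<close>.\<close>

lemma toeplitz_eq_gram:
  assumes "0 < t" "t < 1" "0 < t'" "t' < 1"
  shows "toeplitz s t t' i j = (1 / t' ^ i) * ((1 / t ^ j) * gram s (t * t') i j)"
proof -
  have x: "0 \<le> t * t'" "t * t' < 1"
    using assms mult_strict_mono[of t 1 t' 1] by auto
  have "(shifted_binom s k i * t' ^ (k - i)) * (shifted_binom s k j * t ^ (k - j)) =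
      (1 / t' ^ i) * (1 / t ^ j) * ((t * t') ^ k * shifted_binom s k i * shifted_binom s k j)" for k
    using assms by (auto simp: shifted_binom_def power_diff power_mult_distrib)
  then have "toeplitz s t t' i j = (1 / t' ^ i) * (1 / t ^ j) * gram s (t * t') i j"
    unfolding toeplitz_def gram_def by (simp only: suminf_mult[OF summable_gram[OF x]])
  then show ?thesis by simp
qed

lemma toeplitz_0_left: "toeplitz s 0 t' i j = shifted_binom s j i * t' ^ (j - i)"
proof -
  \<comment> \<open>\<open>0 ^ (k - j)\<close> is 1 for all \<open>k \<le> j\<close>, but the cutoff
    in \<open>shifted_binom\<close> removes \<open>k < j\<close>, so only \<open>k = j\<close>
    survives.\<close>
  have "(\<Sum>k. (shifted_binom s k i * t' ^ (k - i)) * (shifted_binom s k j * 0 ^ (k - j))) =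
      (\<Sum>k\<in>{j}. (shifted_binom s k i * t' ^ (k - i)) * (shifted_binom s k j * 0 ^ (k - j)))"
    by (rule suminf_finite) (auto simp: shifted_binom_def power_0_left)
  then show ?thesis by (simp add: toeplitz_def shifted_binom_def)
qed

lemma fdet_toeplitz_0: "fdet N (toeplitz s 0 t') = 1"
  by (subst fdet_upper_triangular) (auto simp: toeplitz_0_left shifted_binom_def)

lemma fdet_toeplitz_swap: "fdet N (toeplitz s t t') = fdet N (toeplitz s t' t)"
proof -
  have "toeplitz s t t' = (\<lambda>i j. toeplitz s t' t j i)"
    by (intro ext toeplitz_swap)
  then show ?thesis using fdet_transpose[of N "toeplitz s t' t"] by simp
qed

lemma fdet_toeplitz_gram:
  assumes "0 < t" "t < 1" "0 < t'" "t' < 1"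
  shows "fdet N (toeplitz s t t') = fdet N (gram s (t * t')) / (t * t') ^ (\<Sum>i<N. i)"
proof -
  have "fdet N (toeplitz s t t') = (\<Prod>i<N. 1 / t' ^ i) * ((\<Prod>i<N. 1 / t ^ i) * fdet N (gram s (t * t')))"
    by (simp only: toeplitz_eq_gram[OF assms] fdet_mult_rows fdet_mult_cols cong: fdet_cong)
  then show ?thesis
    by (simp add: prod_dividef power_sum power_mult_distrib prod.distrib ac_simps)
qed

section \<open>Asymptotics\<close>

text \<open>The existential \<open>D\<close> unites two cases: \<open>toeplitz_ratio\<close> for
  positive \<open>t\<close> and \<open>t'\<close>, and the value 1 when one of them vanishes, where
  the Toeplitz matrix is triangular with unit diagonal.\<close>

lemma hilbert_series_scaled_bounds:
  assumes "0 \<le> t" "t < 1" "0 \<le> t'" "t' < 1" "N \<le> n" "0 < n"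
  shows "\<exists>D. hilbert_series n N t t' = of_real (D / (1 - t * t') ^ n\<^sup>2) \<and> D \<le> 1 \<and>
    1 - (\<Sum>l\<in>{N<..n}. (t * t') ^ l * (real (n choose l))\<^sup>2) \<le> D"
proof -
  have n: "n = Suc (n - 1)" using assms by simp
  have hs: "hilbert_series n N t t' = of_real (fdet N (toeplitz (n - 1) t t'))"
    using hilbert_series_eq_toeplitz[OF assms(1-4), of "n - 1" N] n by simp
  show ?thesis
  proof (cases "t = 0 \<or> t' = 0")
    case True
    then have "fdet N (toeplitz (n - 1) t t') = 1"
      using fdet_toeplitz_0[of N "n - 1"] fdet_toeplitz_swap[of N "n - 1" t t'] by auto
    then show ?thesis
      using True hs by (intro exI[of _ 1]) (auto intro!: sum_nonneg)
  next
    case False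
    then have pos: "0 < t" "0 < t'" using assms by auto
    then have x: "0 < t * t'" "t * t' < 1"
      using assms mult_strict_mono[of t 1 t' 1] by auto
    have "fdet N (toeplitz (n - 1) t t') = toeplitz_ratio n (t * t') N / (1 - t * t') ^ n\<^sup>2"
      using fdet_toeplitz_gram[of t t' N "n - 1"] pos assms x by (simp add: toeplitz_ratio_def)
    then show ?thesis
      using hs toeplitz_ratio_bounds[OF assms(5,6) x] by (intro exI[of _ "toeplitz_ratio n (t * t') N"]) simp
  qed
qed

section \<open>Bounds for the correction and the error\<close>

text \<open>The first parameter is the nonpositive integer \<open>- (n - N - 1)\<close>, so the
  series is a polynomial. Its coefficients are at most \<open>(n - N - 1 choose k) * r ^ k\<close>
  in absolute value, and the binomial theorem sums these.\<close>

lemma calF_bound: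
  assumes "real n = r * real N" "N < n" "1 \<le> r" "0 \<le> x"
  shows "\<bar>calF N r x\<bar> \<le> (1 + r * x) ^ (n - N - 1)"
proof -
  let ?m = "n - N - 1"
  let ?f = "fps_hypergeo [- real ?m, real n] [real N + 2] (1::real)"
  have a: "- (r - 1) * real N + 1 = - real ?m"
    using assms by (simp add: algebra_simps of_nat_diff)
  have F: "calF N r x = (\<Sum>k. fps_nth ?f k * x ^ k)"
    by (simp only: calF_def gauss_2F1_def eval_fps_def a assms(1)[symmetric])
  have nth: "fps_nth ?f k = (pochhammer (- real ?m) k / fact k) * (pochhammer (real n) k / pochhammer (real N + 2) k)" for k
    by simp
  have b: "\<bar>pochhammer (- real ?m) k / fact k\<bar> = real (?m choose k)" for k
  proof -
    have "real (?m choose k) = (-1) ^ k * pochhammer (- real ?m) k / fact k"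
      by (simp add: binomial_gbinomial gbinomial_pochhammer)
    then have "\<bar>real (?m choose k)\<bar> = \<bar>pochhammer (- real ?m) k / fact k\<bar>"
      by (simp add: abs_mult power_abs)
    then show ?thesis by simp
  qed
  have c: "0 \<le> pochhammer (real n) k / pochhammer (real N + 2) k \<and>
      pochhammer (real n) k / pochhammer (real N + 2) k \<le> r ^ k" for k
  proof (induction k)
    case (Suc k)
    have "real n + real k \<le> r * (real N + 2 + real k)"
      using assms mult_right_mono[of 1 r "2 + real k"] by (simp add: algebra_simps)
    then have "(real n + real k) / (real N + 2 + real k) \<le> r"
      by (simp add: divide_le_eq)
    then have "pochhammer (real n) k / pochhammer (real N + 2) k * ((real n + real k) / (real N + 2 + real k)) \<le> r ^ k * r"
      using Suc assms by (intro mult_mono) auto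
    moreover have "0 \<le> pochhammer (real n) k / pochhammer (real N + 2) k * ((real n + real k) / (real N + 2 + real k))"
      using Suc by (intro mult_nonneg_nonneg) auto
    ultimately show ?case by (simp add: pochhammer_Suc mult.commute)
  qed simp
  have "calF N r x = (\<Sum>k\<le>?m. fps_nth ?f k * x ^ k)"
    unfolding F by (rule suminf_finite) (auto simp: pochhammer_of_nat_eq_0_lemma)
  also have "\<bar>\<dots>\<bar> \<le> (\<Sum>k\<le>?m. \<bar>fps_nth ?f k * x ^ k\<bar>)"
    by (rule sum_abs)
  also have "\<dots> \<le> (\<Sum>k\<le>?m. real (?m choose k) * (r * x) ^ k)"
  proof (rule sum_mono)
    fix k
    have "\<bar>fps_nth ?f k * x ^ k\<bar> = real (?m choose k) * (pochhammer (real n) k / pochhammer (real N + 2) k) * x ^ k"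
      by (simp only: nth abs_mult b abs_of_nonneg[OF conjunct1[OF c]] abs_of_nonneg[OF zero_le_power[OF assms(4)]])
    also have "\<dots> \<le> real (?m choose k) * r ^ k * x ^ k"
      using c[of k] assms(4) by (intro mult_right_mono mult_left_mono) auto
    finally show "\<bar>fps_nth ?f k * x ^ k\<bar> \<le> real (?m choose k) * (r * x) ^ k"
      by (simp add: power_mult_distrib)
  qed
  also have "\<dots> = (1 + r * x) ^ ?m"
    using binomial_ring[of "r * x" 1 ?m] by (simp add: add.commute)
  finally show ?thesis .
qed

text \<open>A single majorant for the error of the determinant ratio and for the explicit correction
  term. The power of \<open>1 + r\<close> dominates both the number of summands and the
  hypergeometric factor.\<close>

lemma correction_bounds:
  assumes "real n = r * real N" "N \<le> n" "1 \<le> r" "0 \<le> x" "x \<le> 1"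
    and M: "\<And>l. N < l \<Longrightarrow> l \<le> n \<Longrightarrow> real (n choose l) \<le> M"
  shows "(\<Sum>l\<in>{N<..n}. x ^ l * (real (n choose l))\<^sup>2) \<le> M\<^sup>2 * (1 + r) ^ (2 * (n - N)) * x ^ N"
    and "(real (n choose (N + 1)))\<^sup>2 * (calF N r x)\<^sup>2 * x ^ (N + 1) \<le> M\<^sup>2 * (1 + r) ^ (2 * (n - N)) * x ^ N"
proof -
  have nonneg: "0 \<le> M\<^sup>2 * (1 + r) ^ (2 * (n - N)) * x ^ N"
    using assms by auto
  have sq: "(real (n choose l))\<^sup>2 \<le> M\<^sup>2" if "N < l" "l \<le> n" for l
    using M[OF that] by (intro power_mono) auto
  have "(\<Sum>l\<in>{N<..n}. x ^ l * (real (n choose l))\<^sup>2) \<le> (\<Sum>l\<in>{N<..n}. x ^ N * M\<^sup>2)"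
    using assms sq by (intro sum_mono mult_mono power_decreasing) auto
  also have "\<dots> = M\<^sup>2 * real (n - N) * x ^ N"
    by simp
  also have "\<dots> \<le> M\<^sup>2 * (1 + r) ^ (2 * (n - N)) * x ^ N"
  proof -
    have "real (n - N) \<le> 2 ^ (n - N)"
      using less_exp[of "n - N"] by (metis less_imp_le of_nat_le_iff of_nat_numeral of_nat_power)
    also have "\<dots> \<le> (1 + r) ^ (n - N)" using assms by (intro power_mono) auto
    also have "\<dots> \<le> (1 + r) ^ (2 * (n - N))" using assms by (intro power_increasing) auto
    finally show ?thesis using assms by (intro mult_right_mono mult_left_mono) auto
  qed
  finally show "(\<Sum>l\<in>{N<..n}. x ^ l * (real (n choose l))\<^sup>2) \<le> M\<^sup>2 * (1 + r) ^ (2 * (n - N)) * x ^ N" .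
  show "(real (n choose (N + 1)))\<^sup>2 * (calF N r x)\<^sup>2 * x ^ (N + 1) \<le> M\<^sup>2 * (1 + r) ^ (2 * (n - N)) * x ^ N"
  proof (cases "N < n")
    case True
    have "\<bar>calF N r x\<bar> \<le> (1 + r * x) ^ (n - N - 1)"
      using assms True by (intro calF_bound) auto
    also have "\<dots> \<le> (1 + r) ^ (n - N - 1)"
      using assms mult_left_mono[of x 1 r] by (intro power_mono) auto
    also have "\<dots> \<le> (1 + r) ^ (n - N)"
      using assms by (intro power_increasing) auto
    finally have "\<bar>calF N r x\<bar>\<^sup>2 \<le> ((1 + r) ^ (n - N))\<^sup>2"
      by (intro power_mono) auto
    then have "(calF N r x)\<^sup>2 \<le> (1 + r) ^ (2 * (n - N))"
      by (simp add: power_mult mult.commute flip: power_mult)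
    then show ?thesis
      using True sq[of "N + 1"] assms by (intro mult_mono power_decreasing) auto
  next
    case False
    then show ?thesis using nonneg by (simp add: binomial_eq_0)
  qed
qed

section \<open>The two regimes\<close>

text \<open>A single term of the expansion of \<open>(1 + y) ^ n\<close>. For small \<open>y\<close>
  the growth rate is close to 1, and the price \<open>y ^ (n - N)\<close> is mild when
  \<open>n - N\<close> is small against \<open>N\<close>; the bound \<open>2 ^ n\<close> would be
  too weak for fixed \<open>x\<close> near 1.\<close>

lemma binomial_le_weighted:
  assumes "N < l" "l \<le> n" "0 < y" "y \<le> (1::real)"
  shows "real (n choose l) \<le> (1 + y) ^ n / y ^ (n - N)"
proof -
  have "real (n choose l) * y ^ (n - N) \<le> real (n choose l) * y ^ (n - l)"
    using assms by (intro mult_left_mono power_decreasing) auto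
  also have "\<dots> = real (n choose (n - l)) * y ^ (n - l)"
    using assms by (simp add: binomial_symmetric[of l n])
  also have "\<dots> \<le> (\<Sum>k\<le>n. real (n choose k) * y ^ k)"
    using assms by (intro member_le_sum[of "n - l" "{..n}" "\<lambda>k. real (n choose k) * y ^ k"]) auto
  also have "\<dots> = (1 + y) ^ n"
    using binomial_ring[of y 1 n] by (simp add: add.commute)
  finally show ?thesis
    using assms by (simp add: pos_le_divide_eq)
qed

lemma tendsto_0_power_bound:
  fixes f :: "nat \<Rightarrow> real" and N :: "nat \<Rightarrow> nat"
  assumes "filterlim N at_top sequentially" "0 \<le> q" "q < 1"
    and "\<forall>\<^sub>F k in sequentially. 0 \<le> f k \<and> f k \<le> q ^ N k"
  shows "f \<longlonglongrightarrow> 0"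
proof (rule tendsto_sandwich[where f = "\<lambda>_. 0" and h = "\<lambda>k. q ^ N k"])
  show "(\<lambda>k. q ^ N k) \<longlonglongrightarrow> 0"
    using filterlim_compose[OF LIMSEQ_power_zero[of q] assms(1)] assms by simp
qed (use assms(4) in \<open>auto elim: eventually_mono\<close>)

text \<open>When \<open>r\<close> tends to 1, the factors with exponent
  \<open>Nf - Nc = (r - 1) * Nc\<close> grow at a rate tending to 1, and the weighted binomial bound
  keeps the remaining rate below 1. When \<open>x\<close> tends to 0 and \<open>r\<close> is fixed,
  all factors but \<open>x ^ Nc\<close> grow at most geometrically in \<open>Nc\<close>, so crude
  bounds suffice.\<close>

lemma regime_bound:
  fixes Nc Nf :: "nat \<Rightarrow> nat" and r x :: "nat \<Rightarrow> real"
  assumes Nc_lim: "filterlim Nc at_top sequentially"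
    and Nf_eq: "\<And>k. real (Nf k) = r k * real (Nc k)"
    and r_ge: "\<And>k. r k \<ge> 1"
    and x: "\<And>k. 0 \<le> x k \<and> x k < 1"
    and regime: "(r \<longlonglongrightarrow> 1 \<and> (\<exists>x0. \<forall>k. x k = x0)) \<or> (x \<longlonglongrightarrow> 0 \<and> (\<exists>r0. \<forall>k. r k = r0))"
  obtains q M where "0 \<le> q" "q < 1"
    and "\<And>k l. Nc k < l \<Longrightarrow> l \<le> Nf k \<Longrightarrow> real (Nf k choose l) \<le> M k"
    and "\<forall>\<^sub>F k in sequentially.
      (M k)\<^sup>2 * (1 + r k) ^ (2 * (Nf k - Nc k)) * x k ^ Nc k \<le> q ^ Nc k"
proof -
  have le: "Nc k \<le> Nf k" for k
    using mult_right_mono[OF r_ge[of k], of "real (Nc k)"] Nf_eq[of k] by simp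
  from regime show thesis
  proof (elim disjE conjE exE)
    fix x0 assume r1: "r \<longlonglongrightarrow> 1" and x0: "\<forall>k. x k = x0"
    have x01: "0 \<le> x0" "x0 < 1" using x[of 0] x0 by auto
    \<comment> \<open>The 6 makes \<open>x0 + 3 * y\<close> equal to \<open>(1 + x0) / 2\<close>,
      which keeps \<open>q0\<close> below 1.\<close>
    define y where "y = (1 - x0) / 6"
    have y: "0 < y" "y \<le> 1" using x01 by (auto simp: y_def)
    \<comment> \<open>\<open>B\<close> bounds the cost of one unit of \<open>Nf k - Nc k\<close>;
      the 9 comes from \<open>1 + r k < 3\<close>, which holds eventually.\<close>
    define B where "B = (1 + y)\<^sup>2 / y\<^sup>2 * 9"
    have B: "0 < B" using y by (auto simp: B_def)
    define q0 where "q0 = (1 + y)\<^sup>2 * x0"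
    have "(1 + y)\<^sup>2 \<le> 1 + 3 * y"
      using y mult_left_mono[of y 1 y] by (simp add: power2_eq_square algebra_simps)
    then have "q0 \<le> (1 + 3 * y) * x0"
      unfolding q0_def using x01 by (intro mult_right_mono) auto
    also have "\<dots> \<le> x0 + 3 * y"
      using x01 y mult_left_mono[of x0 1 y] by (simp add: algebra_simps)
    also have "\<dots> < 1" using x01 by (simp add: y_def field_simps)
    finally have q0: "0 \<le> q0" "q0 < 1" using x01 by (auto simp: q0_def)
    \<comment> \<open>Midway between \<open>q0\<close> and 1, \<open>q\<close> leaves room for the
      factor \<open>B powr (r k - 1)\<close>, which tends to 1.\<close>
    define q where "q = (1 + q0) / 2"
    have q: "0 \<le> q" "q < 1" "q0 < q" using q0 by (auto simp: q_def)
    have "(\<lambda>k. q0 * B powr (r k - 1)) \<longlonglongrightarrow> q0 * B powr (1 - 1)"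
      using B r1 by (intro tendsto_intros) auto
    then have ev1: "\<forall>\<^sub>F k in sequentially. q0 * B powr (r k - 1) < q"
      using q B by (intro order_tendstoD) auto
    have ev2: "\<forall>\<^sub>F k in sequentially. r k < 2"
      using order_tendstoD(2)[OF r1, of 2] by simp
    show thesis
    proof (rule that[OF q(1,2)])
      show "real (Nf k choose l) \<le> (1 + y) ^ Nf k / y ^ (Nf k - Nc k)"
        if "Nc k < l" "l \<le> Nf k" for k l
        by (rule binomial_le_weighted[OF that y])
      show "\<forall>\<^sub>F k in sequentially. ((1 + y) ^ Nf k / y ^ (Nf k - Nc k))\<^sup>2 *
          (1 + r k) ^ (2 * (Nf k - Nc k)) * x k ^ Nc k \<le> q ^ Nc k"
        using ev1 ev2
      proof eventually_elim
        case (elim k)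
        obtain d where d: "Nf k = Nc k + d" using le le_Suc_ex by blast
        have dr: "real d = (r k - 1) * real (Nc k)"
          using Nf_eq[of k] d by (simp add: algebra_simps)
        have "B ^ d = (B powr (r k - 1)) ^ Nc k"
          using B by (simp add: powr_realpow[symmetric] powr_powr dr)
        have "((1 + y) ^ Nf k / y ^ (Nf k - Nc k))\<^sup>2 * (1 + r k) ^ (2 * (Nf k - Nc k)) * x k ^ Nc k =
            q0 ^ Nc k * ((1 + y)\<^sup>2 / y\<^sup>2 * (1 + r k)\<^sup>2) ^ d"
          using x0 by (simp add: d q0_def power_mult_distrib power_divide power_add power_mult[symmetric] mult.commute)
        also have "\<dots> \<le> q0 ^ Nc k * B ^ d"
        proof -
          have "(1 + r k)\<^sup>2 \<le> 3\<^sup>2" using elim r_ge[of k] by (intro power_mono) auto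
          then have "(1 + y)\<^sup>2 / y\<^sup>2 * (1 + r k)\<^sup>2 \<le> (1 + y)\<^sup>2 / y\<^sup>2 * 9"
            by (intro mult_left_mono) auto
          then show ?thesis
            using q0 by (intro mult_left_mono power_mono) (auto simp: B_def)
        qed
        also have "\<dots> = (q0 * B powr (r k - 1)) ^ Nc k"
          by (simp add: \<open>B ^ d = _\<close> power_mult_distrib)
        also have "\<dots> \<le> q ^ Nc k"
          using elim q0 by (intro power_mono) auto
        finally show ?case .
      qed
    qed
  next
    fix r0 assume x0: "x \<longlonglongrightarrow> 0" and r0: "\<forall>k. r k = r0"
    \<comment> \<open>The natural bound \<open>R\<close> on \<open>r0\<close> lets the growth of all
      factors be collected in one constant \<open>B\<close> per unit of \<open>Nc k\<close>.\<close>
    define R where "R = nat \<lceil>r0\<rceil>"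
    have r01: "1 \<le> r0" using r_ge[of 0] r0 by simp
    have NfR: "Nf k \<le> R * Nc k" for k
    proof -
      have "real (Nf k) \<le> real R * real (Nc k)"
        unfolding Nf_eq R_def using r0 r01 by (intro mult_right_mono) (auto simp: real_nat_ceiling_ge)
      then show ?thesis by (metis of_nat_le_iff of_nat_mult)
    qed
    define B where "B = (4 * (1 + r0)\<^sup>2) ^ R"
    have "(\<lambda>k. B * x k) \<longlonglongrightarrow> B * 0"
      by (intro tendsto_intros x0)
    then have ev: "\<forall>\<^sub>F k in sequentially. B * x k < 1 / 2"
      by (intro order_tendstoD) auto
    show thesis
    proof (rule that[of "1 / 2" "\<lambda>k. 2 ^ Nf k"])
      show "real (Nf k choose l) \<le> 2 ^ Nf k" for k l
        using binomial_le_pow2[of "Nf k" l] by (metis of_nat_le_iff of_nat_numeral of_nat_power)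
      show "\<forall>\<^sub>F k in sequentially. (2 ^ Nf k)\<^sup>2 * (1 + r k) ^ (2 * (Nf k - Nc k)) * x k ^ Nc k \<le> (1 / 2) ^ Nc k"
        using ev
      proof eventually_elim
        case (elim k)
        have "(2 ^ Nf k)\<^sup>2 * (1 + r k) ^ (2 * (Nf k - Nc k)) * x k ^ Nc k \<le>
            (2 ^ Nf k)\<^sup>2 * (1 + r0) ^ (2 * Nf k) * x k ^ Nc k"
          using x[of k] r0 r01 by (intro mult_right_mono mult_left_mono power_increasing) auto
        also have "\<dots> = (4 * (1 + r0)\<^sup>2) ^ Nf k * x k ^ Nc k"
        proof -
          have "((2::real) ^ Nf k)\<^sup>2 = 4 ^ Nf k"
            by (simp add: power2_eq_square flip: power_mult_distrib)
          then show ?thesis by (simp add: power_mult_distrib power_mult)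
        qed
        also have "\<dots> \<le> (4 * (1 + r0)\<^sup>2) ^ (R * Nc k) * x k ^ Nc k"
        proof -
          have "1 \<le> (1 + r0)\<^sup>2" using r01 by (intro one_le_power) auto
          then show ?thesis
            using x[of k] by (intro mult_right_mono power_increasing NfR) auto
        qed
        also have "\<dots> = (B * x k) ^ Nc k"
          by (simp only: B_def power_mult power_mult_distrib[of _ "x k"])
        also have "\<dots> \<le> (1 / 2) ^ Nc k"
          using elim x[of k] r01 by (intro power_mono) (auto simp: B_def)
        finally show ?case .
      qed
    qed auto
  qed
qed

theorem mainTheorem12:
  fixes Nc Nf :: "nat \<Rightarrow> nat" and r t t' :: "nat \<Rightarrow> real"
  assumes Nc_lim: "filterlim Nc at_top sequentially"
    and Nc_pos: "\<And>k. Nc k \<ge> 1"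
    and Nf_eq: "\<And>k. real (Nf k) = r k * real (Nc k)"
    and r_ge: "\<And>k. r k \<ge> 1"
    and t_range: "\<And>k. 0 \<le> t k \<and> t k < 1"
    and t'_range: "\<And>k. 0 \<le> t' k \<and> t' k < 1"
    and regime:
      "((\<lambda>k. r k - 1) \<in> o[sequentially](\<lambda>_. 1) \<and>
          (\<exists>t0 t0'. 0 < t0 * t0' \<and> t0 * t0' < 1 \<and> (\<forall>k. t k = t0 \<and> t' k = t0')))
       \<or> ((\<lambda>k. t k * t' k) \<in> o[sequentially](\<lambda>_. 1) \<and>
          (\<exists>r0>1. \<forall>k. r k = r0))"
  shows "(\<lambda>k. hilbert_series (Nf k) (Nc k) (t k) (t' k) /
           complex_of_real
             ((1 - (real (Nf k choose (Nc k + 1)))\<^sup>2 * (calF (Nc k) (r k) (t k * t' k))\<^sup>2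
                     * (t k * t' k) ^ (Nc k + 1))
              / (1 - t k * t' k) powr ((r k)\<^sup>2 * (real (Nc k))\<^sup>2)))
         \<longlonglongrightarrow> 1"
proof -
  let ?x = "\<lambda>k. t k * t' k"
  let ?c = "\<lambda>k. (real (Nf k choose (Nc k + 1)))\<^sup>2 * (calF (Nc k) (r k) (?x k))\<^sup>2 * ?x k ^ (Nc k + 1)"
  let ?e = "\<lambda>k. \<Sum>l\<in>{Nc k<..Nf k}. ?x k ^ l * (real (Nf k choose l))\<^sup>2"
  have x: "0 \<le> ?x k \<and> ?x k < 1" for k
    using t_range[of k] t'_range[of k] mult_strict_mono'[of "t k" 1 "t' k" 1] by auto
  have le: "Nc k \<le> Nf k" for k
    using mult_right_mono[OF r_ge[of k], of "real (Nc k)"] Nf_eq[of k] by simp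
  have pos: "0 < Nf k" for k
    using le[of k] Nc_pos[of k] by simp
  \<comment> \<open>Little-o of 1 is convergence to 0; of \<open>t\<close> and \<open>t'\<close>
    only the product enters the estimates.\<close>
  have "(r \<longlonglongrightarrow> 1 \<and> (\<exists>x0. \<forall>k. ?x k = x0)) \<or> (?x \<longlonglongrightarrow> 0 \<and> (\<exists>r0. \<forall>k. r k = r0))"
    using regime
  proof (elim disjE conjE)
    assume "(\<lambda>k. r k - 1) \<in> o[sequentially](\<lambda>_. 1)"
      "\<exists>t0 t0'. 0 < t0 * t0' \<and> t0 * t0' < 1 \<and> (\<forall>k. t k = t0 \<and> t' k = t0')"
    then show ?thesis
      by (auto dest!: smalloD_tendsto simp: LIM_zero_iff)
  next
    assume "?x \<in> o[sequentially](\<lambda>_. 1)" "\<exists>r0>1. \<forall>k. r k = r0"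
    then show ?thesis by (auto dest!: smalloD_tendsto)
  qed
  then obtain q M where q: "0 \<le> q" "q < 1"
    and M: "\<And>k l. Nc k < l \<Longrightarrow> l \<le> Nf k \<Longrightarrow> real (Nf k choose l) \<le> M k"
    and ev: "\<forall>\<^sub>F k in sequentially. (M k)\<^sup>2 * (1 + r k) ^ (2 * (Nf k - Nc k)) * ?x k ^ Nc k \<le> q ^ Nc k"
    by (rule regime_bound[OF Nc_lim Nf_eq r_ge x]) (rule that)
  have ce: "?e k \<le> (M k)\<^sup>2 * (1 + r k) ^ (2 * (Nf k - Nc k)) * ?x k ^ Nc k"
    "?c k \<le> (M k)\<^sup>2 * (1 + r k) ^ (2 * (Nf k - Nc k)) * ?x k ^ Nc k" for k
    using correction_bounds[OF Nf_eq[of k] le r_ge, of "?x k" "M k"] x[of k] M by auto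
  have e: "?e \<longlonglongrightarrow> 0"
    by (rule tendsto_0_power_bound[OF Nc_lim q], rule eventually_mono[OF ev])
      (use ce(1) x in \<open>auto intro!: sum_nonneg intro: order_trans\<close>)
  have c: "?c \<longlonglongrightarrow> 0"
    by (rule tendsto_0_power_bound[OF Nc_lim q], rule eventually_mono[OF ev])
      (use ce(2) x in \<open>auto intro: order_trans\<close>)
  have "\<exists>D. \<forall>k. hilbert_series (Nf k) (Nc k) (t k) (t' k) = of_real (D k / (1 - ?x k) ^ (Nf k)\<^sup>2) \<and>
      D k \<le> 1 \<and> 1 - ?e k \<le> D k"
    using t_range t'_range le pos by (intro choice allI hilbert_series_scaled_bounds) auto
  then obtain D where D: "\<And>k. hilbert_series (Nf k) (Nc k) (t k) (t' k) = of_real (D k / (1 - ?x k) ^ (Nf k)\<^sup>2)"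
    "\<And>k. D k \<le> 1" "\<And>k. 1 - ?e k \<le> D k"
    by blast
  have "D \<longlonglongrightarrow> 1"
  proof (rule tendsto_sandwich[where f = "\<lambda>k. 1 - ?e k" and h = "\<lambda>_. 1"])
    show "(\<lambda>k. 1 - ?e k) \<longlonglongrightarrow> 1"
      using tendsto_diff[OF tendsto_const[of "1::real"] e] by simp
  qed (use D(2,3) in auto)
  \<comment> \<open>\<open>D\<close> is squeezed to 1, and the numerator \<open>1 - ?c\<close> of
    the formula tends to 1 by the same majorant.\<close>
  then have "(\<lambda>k. D k / (1 - ?c k)) \<longlonglongrightarrow> 1 / (1 - 0)"
    by (intro tendsto_divide tendsto_diff tendsto_const c) auto
  then have "(\<lambda>k. complex_of_real (D k / (1 - ?c k))) \<longlonglongrightarrow> of_real 1"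
    by (intro tendsto_of_real) simp
  moreover have "hilbert_series (Nf k) (Nc k) (t k) (t' k) /
      complex_of_real ((1 - ?c k) / (1 - ?x k) powr ((r k)\<^sup>2 * (real (Nc k))\<^sup>2)) =
      complex_of_real (D k / (1 - ?c k))" for k
  proof -
    \<comment> \<open>\<open>r k * Nc k\<close> is the natural number \<open>Nf k\<close>, so the
      real power is an ordinary one and cancels against the denominator of the Hilbert
      series.\<close>
    have "(r k)\<^sup>2 * (real (Nc k))\<^sup>2 = real ((Nf k)\<^sup>2)"
      using Nf_eq[of k] by (simp add: power_mult_distrib)
    then have "(1 - ?x k) powr ((r k)\<^sup>2 * (real (Nc k))\<^sup>2) = (1 - ?x k) ^ (Nf k)\<^sup>2"
      using x[of k] by (simp only: powr_realpow diff_gt_0_iff_gt)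
    then show ?thesis
      unfolding D(1) of_real_divide[symmetric] using x[of k] by simp
  qed
  ultimately show ?thesis by (simp only: of_real_1)
qed

end
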